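(* For every unit interval graph $G$ on $[n]$, $$Y_G\equiv_n\frac{1}{n!}\sum_{D'\in\mathcal A'_L(G)}(-1)^{t(D')}\,e_{\pi(D')}.$$
   Context: Work in $\mathrm{NCSym}$ (symmetric functions in non-commuting variables $x_1,x_2,\dots$ over $\mathbb Q$). For $\pi\vdash[n]$, $e_\pi=\sum x_{i_1}\cdots x_{i_n}$ over tuples with $i_j\ne i_k$ whenever $j\ne k$ are in a common block of $\pi$. For a simple graph $G$ on vertex set $[n]$, $Y_G=\sum_\kappa x_{\kappa(1)}\cdots x_{\kappa(n)}$ over proper colorings $\kappa:[n]\to\{1,2,\dots\}$. A unit interval graph $G$ on $[n]$ is given by intervals $[a_1,1],\dots,[a_n,n]$ with $1\le a_1\le\cdots\le a_n$, $a_k\le k$, with an edge between distinct $i,j$ whenever $i,j\in[a_k,k]$ for some $k$. An arc diagram on $[n]$ is a set of arcs $(i,j)$, $i<j$, with each vertex the right endpoint of at most one arc; $\mathcal A(G)$ is the set of arc diagrams all of whose arcs $(i,j)$ satisfy $i,j\in[a_k,k]$ for some $k$. A tic-marking of $D$ is a choice of subset $T$ of its arcs (carrying tic marks); $t=|T|$. Connected components are those of the graph on $[n]$ with arcs as edges. Pieces: if a component $C$ has tic-marked arcs with right endpoints $j_1<\dots<j_r$, its pieces are $C\cap[1,j_1-1],C\cap[j_1,j_2-1],\dots,C\cap[j_r,n]$; the right-most piece of $C$ is the one containing $\max C$. $\mathcal A'_L(G)$ is the set of all quadruples $D'=(D,T,\delta,S)$ with $D\in\mathcal A(G)$, $T$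 a set of arcs of $D$, $\delta\in\mathfrak S_n$ a labeling ($\delta(i)$ placed on vertex $i$) that is increasing on each piece (if $b_1<\dots<b_k$ are the vertices of a piece then $\delta(b_1)<\dots<\delta(b_k)$), and $S$ a set of starred vertices containing exactly one vertex from the right-most piece of each connected component and no other vertices. $t(D')=|T|$ and $\pi(D')\vdash[n]$ is the set partition into all pieces. Equivalence: $\pi\sim\sigma$ for $\pi,\sigma\vdash[n]$ if they have the same multiset of block sizes and the blocks containing $n$ have equal size; for $f,g$ homogeneous of degree $n$, $f\equiv_n g$ means that for every $\sim$-class the sum of the $e$-coefficients of $f$ over that class equals that of $g$. *)

theory Defs
  imports Complex_Main "HOL-Library.Disjoint_Sets" "HOL-Combinatorics.Permutations" "HOL-Library.Multiset"
begin

text \<open>Degree-n homogeneous elements of NCSym are represented by their coefficient functions: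
  the coefficient of the monomial x_(w 1) x_(w 2) ... x_(w n) is given by a function of
  w :: nat \<Rightarrow> nat (only the values on {1..n} matter).\<close>

definition set_partitions :: "nat \<Rightarrow> nat set set set" where
  "set_partitions n = {\<pi>. partition_on {1..n} \<pi>}"

definition e_coeff :: "nat set set \<Rightarrow> (nat \<Rightarrow> nat) \<Rightarrow> rat" where
  "e_coeff \<pi> w = (if \<forall>B\<in>\<pi>. inj_on w B then 1 else 0)"

definition Y_coeff :: "(nat \<Rightarrow> nat \<Rightarrow> bool) \<Rightarrow> nat \<Rightarrow> (nat \<Rightarrow> nat) \<Rightarrow> rat" where
  "Y_coeff E n w = (if \<forall>i\<in>{1..n}. \<forall>j\<in>{1..n}. E i j \<longrightarrow> w i \<noteq> w j then 1 else 0)"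

text \<open>Unit interval data: intervals [a k, k], 1 \<le> a 1 \<le> ... \<le> a n, a k \<le> k.\<close>
definition unit_interval_seq :: "nat \<Rightarrow> (nat \<Rightarrow> nat) \<Rightarrow> bool" where
  "unit_interval_seq n a \<longleftrightarrow>
     (\<forall>k\<in>{1..n}. 1 \<le> a k \<and> a k \<le> k) \<and> (\<forall>k\<in>{1..n}. \<forall>l\<in>{1..n}. k \<le> l \<longrightarrow> a k \<le> a l)"

definition uig_adj :: "nat \<Rightarrow> (nat \<Rightarrow> nat) \<Rightarrow> nat \<Rightarrow> nat \<Rightarrow> bool" where
  "uig_adj n a i j \<longleftrightarrow> i \<noteq> j \<and> (\<exists>k\<in>{1..n}. i \<in> {a k..k} \<and> j \<in> {a k..k})"

definition arc_diagrams :: "nat \<Rightarrow> (nat \<Rightarrow> nat) \<Rightarrow> (nat \<times> nat) set set" where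
  "arc_diagrams n a = {D. D \<subseteq> {(i, j). 1 \<le> i \<and> i < j \<and> j \<le> n}
      \<and> (\<forall>i i' j. (i, j) \<in> D \<longrightarrow> (i', j) \<in> D \<longrightarrow> i = i')
      \<and> (\<forall>(i, j)\<in>D. \<exists>k\<in>{1..n}. i \<in> {a k..k} \<and> j \<in> {a k..k})}"

definition comp :: "nat \<Rightarrow> (nat \<times> nat) set \<Rightarrow> nat \<Rightarrow> nat set" where
  "comp n D v = {u \<in> {1..n}. (v, u) \<in> (D \<union> D\<inverse>)\<^sup>*}"

definition piece :: "nat \<Rightarrow> (nat \<times> nat) set \<Rightarrow> (nat \<times> nat) set \<Rightarrow> nat \<Rightarrow> nat set" where
  "piece n D T v =
     (let C = comp n D v; J = {j \<in> C. \<exists>i. (i, j) \<in> T}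
      in {u \<in> C. card {j \<in> J. j \<le> u} = card {j \<in> J. j \<le> v}})"

definition pieces_partition :: "nat \<Rightarrow> (nat \<times> nat) set \<Rightarrow> (nat \<times> nat) set \<Rightarrow> nat set set" where
  "pieces_partition n D T = {piece n D T v | v. v \<in> {1..n}}"

definition AL' :: "nat \<Rightarrow> (nat \<Rightarrow> nat) \<Rightarrow>
    ((nat \<times> nat) set \<times> (nat \<times> nat) set \<times> (nat \<Rightarrow> nat) \<times> nat set) set" where
  "AL' n a = {(D, T, \<delta>, S).
      D \<in> arc_diagrams n a \<and> T \<subseteq> D \<and> \<delta> permutes {1..n}
    \<and> (\<forall>u\<in>{1..n}. \<forall>v\<in>{1..n}. u \<in> piece n D T v \<and> u < v \<longrightarrow> \<delta> u < \<delta> v)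
    \<and> S \<subseteq> {1..n}
    \<and> (\<forall>v\<in>{1..n}. card (S \<inter> piece n D T (Max (comp n D v))) = 1)
    \<and> (\<forall>s\<in>S. s \<in> piece n D T (Max (comp n D s)))}"

definition sim_part :: "nat \<Rightarrow> nat set set \<Rightarrow> nat set set \<Rightarrow> bool" where
  "sim_part n \<pi> \<sigma> \<longleftrightarrow>
     image_mset card (mset_set \<pi>) = image_mset card (mset_set \<sigma>)
   \<and> card (\<Union>{B \<in> \<pi>. n \<in> B}) = card (\<Union>{B \<in> \<sigma>. n \<in> B})"

end

theory Submission
  imports Defs "HOL-Library.Infinite_Set"
begin

text \<open>Arc diagrams are the edge sets without broken circuits, so \<open>Y\<^sub>G = \<Sum>\<^sub>D (-1)^|D| p\<^sub>D\<close>, where \<open>p\<^sub>D\<close> is the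
  power sum of the partition into connected components. For a component \<open>C\<close> of size \<open>m\<close>,
  \<open>(-1)^(m-1) p\<^sub>C\<close> is the sum of \<open>(-1)^(l-1) (l-1)!/(m-1)! e\<^sub>P\<close> over all partitions \<open>P\<close> of \<open>C\<close>, \<open>l\<close> being the
  number of blocks. On the other side, the tic marks on \<open>C\<close> cut it into consecutive segments of sizes
  \<open>\<alpha>\<^sub>1, \<dots>, \<alpha>\<^sub>l\<close>, and counting increasing labelings and stars gives the weight
  \<open>(-1)^(l-1) \<alpha>\<^sub>l / (\<alpha>\<^sub>1! \<dots> \<alpha>\<^sub>l!)\<close>. Collecting terms by the multiset of block sizes and the size of the
  block containing the maximum of \<open>C\<close>, the two weights agree for every component separately.\<close>

section \<open>Sums over set partitions\<close>

text \<open>Agreement of the weights on each component does not by itself give agreement of class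
  sums, because the class of a partition of \<open>{1..n}\<close> couples all components through the
  total multiset of block sizes. What is compared on a component \<open>C\<close> is therefore a
  weighted distribution: both weights are summed against an arbitrary function \<open>g\<close> of
  the block sizes and of the size of the block of \<open>Max C\<close>. Such identities can be
  multiplied together factor by factor (\<open>sum_PiE_transfer\<close>). \<open>Max C\<close> is
  the right marked point because it equals \<open>n\<close> in the component of \<open>n\<close>,
  and because the star lies in its segment. With the block of the maximum set aside, (l-1)! orders
  the other blocks, and multinomial coefficients count ordered set partitions with given sizes,
  which leaves the inverse factorials of the segment side. If the marked block has size k, choosing
  its other elements contributes 1/(k-1)!; on the segment side this is k/k!, the k being the choices
  of the star. Class sums refer to coefficients in the e's, so linear independence has to be
  established as well.\<close>

lemma finite_partitions [simp]: "finite A \<Longrightarrow> finite {P. partition_on A P}"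
  by (rule finitely_many_partition_on)

lemma partition_on_finiteD: "partition_on A P \<Longrightarrow> finite A \<Longrightarrow> finite P"
  by (rule finite_elements)

lemma partition_on_empty_eq: "{P. partition_on {} P} = {{}}"
  by (auto simp: partition_on_empty)

lemma partition_on_Diff_block:
  assumes "partition_on A P" "B \<in> P"
  shows "partition_on (A - B) (P - {B})" "B \<subseteq> A" "B \<noteq> {}"
proof -
  have "disjnt B (\<Union>(P - {B}))"
    using partition_onD2[OF assms(1)] assms(2) by (auto simp: disjoint_def disjnt_def)
  then have "partition_on A (insert B (P - {B})) \<longleftrightarrow> partition_on (A - B) (P - {B}) \<and> B \<subseteq> A \<and> B \<noteq> {}"
    by (rule partition_on_insert)
  moreover have "insert B (P - {B}) = P" using assms(2) by auto
  ultimately show "partition_on (A - B) (P - {B})" "B \<subseteq> A" "B \<noteq> {}" using assms(1) by auto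
qed

lemma partition_on_insert_block:
  assumes "partition_on (A - B) Q" "B \<subseteq> A" "B \<noteq> {}"
  shows "partition_on A (insert B Q)" "B \<notin> Q"
proof -
  have "disjnt B (\<Union>Q)"
    using partition_onD1[OF assms(1)] by (auto simp: disjnt_def)
  from partition_on_insert[OF this, of A] show "partition_on A (insert B Q)" using assms by auto
  show "B \<notin> Q" using \<open>disjnt B (\<Union>Q)\<close> assms(3) by (auto simp: disjnt_def)
qed

lemma sum_partitions_distinguished_block:
  fixes f :: "'a set \<Rightarrow> 'a set set \<Rightarrow> 'b::comm_monoid_add"
  assumes "finite A"
  shows "(\<Sum>P | partition_on A P. \<Sum>B\<in>P. f B (P - {B})) =
         (\<Sum>B\<in>Pow A - {{}}. \<Sum>Q | partition_on (A - B) Q. f B Q)"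
proof -
  have "(\<Sum>P | partition_on A P. \<Sum>B\<in>P. f B (P - {B})) =
        (\<Sum>(P, B)\<in>(SIGMA P:{P. partition_on A P}. P). f B (P - {B}))"
    using assms by (subst sum.Sigma) (auto intro: partition_on_finiteD)
  also have "\<dots> = (\<Sum>(B, Q)\<in>(SIGMA B:Pow A - {{}}. {Q. partition_on (A - B) Q}). f B Q)"
    by (rule sum.reindex_bij_witness[of _ "\<lambda>(B, Q). (insert B Q, B)" "\<lambda>(P, B). (B, P - {B})"])
       (auto dest: partition_on_Diff_block partition_on_insert_block(2)
             intro: partition_on_insert_block(1))
  also have "\<dots> = (\<Sum>B\<in>Pow A - {{}}. \<Sum>Q | partition_on (A - B) Q. f B Q)"
    using assms by (subst sum.Sigma) auto
  finally show ?thesis .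
qed

lemma sum_partitions_insert_block:
  fixes f :: "'a set set \<Rightarrow> 'b::comm_monoid_add"
  assumes "finite A" "x \<notin> A"
  shows "(\<Sum>P | partition_on (insert x A) P. f P) =
         (\<Sum>B\<in>Pow A. \<Sum>Q | partition_on (A - B) Q. f (insert (insert x B) Q))"
proof -
  \<comment> \<open>\<open>?h\<close> vanishes unless \<open>x\<close> lies in \<open>B\<close>.
    Exactly one block contains \<open>x\<close>, so summing over all blocks reproduces
    \<open>f P\<close> and the lemma on distinguished blocks applies.\<close>
  let ?h = "\<lambda>B Q. if x \<in> B then f (insert B Q) else 0"
  have "(\<Sum>P | partition_on (insert x A) P. f P) =
        (\<Sum>P | partition_on (insert x A) P. \<Sum>B\<in>P. ?h B (P - {B}))"
  proof (rule sum.cong[OF refl])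
    fix P assume P: "P \<in> {P. partition_on (insert x A) P}"
    then have "\<Union>P = insert x A" by (simp add: partition_on_def)
    then obtain B where B: "B \<in> P" "x \<in> B" by auto
    have uniq: "B' = B" if "B' \<in> P" "x \<in> B'" for B'
      using that B P by (auto simp: partition_on_def disjoint_def)
    have "finite P" using P assms by (auto intro: partition_on_finiteD)
    have "(\<Sum>B\<in>P. ?h B (P - {B})) = (\<Sum>B'\<in>{B}. ?h B' (P - {B'}))"
    proof (rule sum.mono_neutral_right)
      show "\<forall>i\<in>P - {B}. ?h i (P - {i}) = 0" using uniq by (metis DiffE singletonI)
    qed (use B(1) \<open>finite P\<close> in simp_all)
    also have "\<dots> = f P" using B by (simp add: insert_absorb)
    finally show "f P = (\<Sum>B\<in>P. ?h B (P - {B}))" by simp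
  qed
  also have "\<dots> = (\<Sum>B\<in>Pow (insert x A) - {{}}. \<Sum>Q | partition_on (insert x A - B) Q. ?h B Q)"
    using assms by (intro sum_partitions_distinguished_block) auto
  also have "\<dots> = (\<Sum>B\<in>insert x ` Pow A. \<Sum>Q | partition_on (insert x A - B) Q. f (insert B Q))"
  proof (rule sum.mono_neutral_cong_right)
    have *: "B \<in> insert x ` Pow A" if "B \<subseteq> insert x A" "x \<in> B" for B
      using that by (intro image_eqI[of _ _ "B - {x}"]) auto
    show "\<forall>B\<in>Pow (insert x A) - {{}} - insert x ` Pow A.
            (\<Sum>Q | partition_on (insert x A - B) Q. ?h B Q) = 0"
    proof
      fix B assume "B \<in> Pow (insert x A) - {{}} - insert x ` Pow A"
      then have "x \<notin> B" using * by auto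
      then show "(\<Sum>Q | partition_on (insert x A - B) Q. ?h B Q) = 0" by simp
    qed
  qed (use assms in auto)
  also have "\<dots> = (\<Sum>B\<in>Pow A. \<Sum>Q | partition_on (insert x A - insert x B) Q. f (insert (insert x B) Q))"
    using assms(2) by (subst sum.reindex) (auto simp: inj_on_def)
  also have "\<dots> = (\<Sum>B\<in>Pow A. \<Sum>Q | partition_on (A - B) Q. f (insert (insert x B) Q))"
  proof (rule sum.cong[OF refl])
    fix B
    have "insert x A - insert x B = A - B" using assms(2) by auto
    then show "(\<Sum>Q | partition_on (insert x A - insert x B) Q. f (insert (insert x B) Q)) =
      (\<Sum>Q | partition_on (A - B) Q. f (insert (insert x B) Q))" by simp
  qed
  finally show ?thesis .
qed

text \<open>The new point is a singleton block or joins an existing block. The second case is a sum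
  over partitions with a distinguished block, once the empty \<open>B\<close> has been split off in
  \<open>sum_partitions_insert_block\<close>.\<close>

lemma sum_partitions_insert:
  fixes f :: "'a set set \<Rightarrow> 'b::comm_monoid_add"
  assumes "finite A" "x \<notin> A"
  shows "(\<Sum>P | partition_on (insert x A) P. f P) =
         (\<Sum>Q | partition_on A Q. f (insert {x} Q) + (\<Sum>B\<in>Q. f (insert (insert x B) (Q - {B}))))"
proof -
  have "(\<Sum>P | partition_on (insert x A) P. f P) =
     (\<Sum>Q | partition_on A Q. f (insert {x} Q)) +
     (\<Sum>B\<in>Pow A - {{}}. \<Sum>Q | partition_on (A - B) Q. f (insert (insert x B) Q))"
    unfolding sum_partitions_insert_block[OF assms]
    using assms(1) by (subst sum.remove[of _ "{}"]) auto
  also have "(\<Sum>B\<in>Pow A - {{}}. \<Sum>Q | partition_on (A - B) Q. f (insert (insert x B) Q)) =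
     (\<Sum>Q | partition_on A Q. \<Sum>B\<in>Q. f (insert (insert x B) (Q - {B})))"
    by (rule sum_partitions_distinguished_block[OF assms(1), symmetric])
  finally show ?thesis by (simp add: sum.distrib)
qed

section \<open>Power sums in terms of elementary symmetric functions\<close>

text \<open>A block on which \<open>w\<close> is injective contains at most one point of color
  \<open>c\<close>. The number of such blocks is thus the same for all admissible \<open>P\<close>,
  which is what makes the induction for power sums close.\<close>

lemma card_blocks_meeting_color:
  assumes "partition_on A P" "finite A" "\<forall>B\<in>P. inj_on w B"
  shows "card {B \<in> P. c \<in> w ` B} = card {y \<in> A. w y = c}"
proof -
  have fin: "finite P" using assms by (auto intro: partition_on_finiteD)
  have finB: "finite B" if "B \<in> P" for B
    using that assms partition_on_Diff_block(2) finite_subset by metis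
  have "{y \<in> A. w y = c} = (\<Union>B\<in>P. {y \<in> B. w y = c})"
    using partition_onD1[OF assms(1)] by auto
  then have "card {y \<in> A. w y = c} = card (\<Union>B\<in>P. {y \<in> B. w y = c})" by simp
  also have "\<dots> = (\<Sum>B\<in>P. card {y \<in> B. w y = c})"
    using fin finB partition_onD2[OF assms(1)]
    by (intro card_UN_disjoint) (auto simp: disjoint_def)
  also have "\<dots> = (\<Sum>B\<in>P. of_bool (c \<in> w ` B))"
  proof (rule sum.cong[OF refl])
    fix B assume "B \<in> P"
    then have inj: "inj_on w B" using assms by auto
    show "card {y \<in> B. w y = c} = of_bool (c \<in> w ` B)"
    proof (cases "c \<in> w ` B")
      case True
      then obtain y where "y \<in> B" "w y = c" by auto
      then have "{y \<in> B. w y = c} = {y}" using inj by (auto simp: inj_on_def)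
      then show ?thesis using True by simp
    next
      case False
      then have "{y \<in> B. w y = c} = {}" by auto
      then show ?thesis using False by (simp only: card.empty of_bool_eq)
    qed
  qed
  also have "\<dots> = card {B \<in> P. c \<in> w ` B}"
    using fin by (simp add: of_bool_def sum.If_cases Int_def conj_commute)
  finally show ?thesis by simp
qed

lemma e_coeff_insert: "e_coeff (insert B P) w = (if inj_on w B then e_coeff P w else 0)"
  by (auto simp: e_coeff_def)

text \<open>The coefficients are the values of the Moebius function between \<open>P\<close> and the
  one-block partition. When \<open>x\<close> is added to a partition with l+1 blocks, the singleton
  contributes the factor -(l+1) and each block avoiding the color of \<open>x\<close> contributes 1,
  relative to the term of \<open>Q\<close>. The blocks meeting that color number \<open>c\<close>,
  so the total factor is \<open>- c\<close> for every partition. It is \<open>- card A\<close> if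
  \<open>x\<close> has the common color of \<open>A\<close>, and 0 if \<open>A\<close> is constant
  with another color.\<close>

lemma power_sum_eq_sum_e_coeff:
  assumes "finite A" "A \<noteq> {}"
  shows "(\<Sum>P | partition_on A P. (-1) ^ (card P - 1) * fact (card P - 1) * e_coeff P w) =
         (if \<forall>x\<in>A. \<forall>y\<in>A. w x = w y then (-1) ^ (card A - 1) * fact (card A - 1) else 0)"
  using assms
proof (induction rule: finite_ne_induct)
  case (singleton x)
  show ?case
    by (subst sum_partitions_insert) (auto simp: partition_on_empty_eq e_coeff_def)
next
  case (insert x A)
  let ?f = "\<lambda>P. (-1) ^ (card P - 1) * fact (card P - 1) * e_coeff P w :: rat"
  define c where "c = card {y \<in> A. w y = w x}"
  have step: "?f (insert {x} Q) + (\<Sum>B\<in>Q. ?f (insert (insert x B) (Q - {B}))) = - of_nat c * ?f Q"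
    if Q: "partition_on A Q" for Q
  proof -
    have fin: "finite Q" using Q insert by (auto intro: partition_on_finiteD)
    have "Q \<noteq> {}" using Q insert(2) by (auto dest: partition_onD1)
    then obtain l where l: "card Q = Suc l" using fin by (metis card_0_eq not0_implies_Suc)
    have xB: "x \<notin> B" if "B \<in> Q" for B
      using that Q insert(3) by (auto dest: partition_onD1)
    have "{x} \<notin> Q" using xB by auto
    then have 1: "?f (insert {x} Q) = - ((-1) ^ l * fact (Suc l) * e_coeff Q w)"
      using fin l by (simp add: e_coeff_insert)
    have 2: "?f (insert (insert x B) (Q - {B})) = (-1) ^ l * fact l * e_coeff Q w * of_bool (w x \<notin> w ` B)"
      if B: "B \<in> Q" for B
    proof -
      have "insert x B \<notin> Q - {B}" using xB by auto
      then have "card (insert (insert x B) (Q - {B})) = Suc l" using fin l B by simp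
      moreover have "e_coeff (insert (insert x B) (Q - {B})) w = e_coeff Q w * of_bool (w x \<notin> w ` B)"
        using B xB[OF B] by (auto simp: e_coeff_def)
      ultimately show ?thesis by simp
    qed
    have 3: "(\<Sum>B\<in>Q. ?f (insert (insert x B) (Q - {B}))) =
       (-1) ^ l * fact l * e_coeff Q w * of_nat (card {B \<in> Q. w x \<notin> w ` B})"
    proof -
      have "(\<Sum>B\<in>Q. ?f (insert (insert x B) (Q - {B}))) =
        (\<Sum>B\<in>Q. (-1) ^ l * fact l * e_coeff Q w * of_bool (w x \<notin> w ` B))"
        using 2 by (intro sum.cong) auto
      also have "\<dots> = (-1) ^ l * fact l * e_coeff Q w * (\<Sum>B\<in>Q. of_bool (w x \<notin> w ` B))"
        by (simp add: sum_distrib_left)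
      also have "(\<Sum>B\<in>Q. of_bool (w x \<notin> w ` B)) = (of_nat (card {B \<in> Q. w x \<notin> w ` B}) :: rat)"
        using fin by (simp add: of_bool_def sum.If_cases Int_def conj_commute)
      finally show ?thesis .
    qed
    show ?thesis
    proof (cases "\<forall>B\<in>Q. inj_on w B")
      case False
      then have "e_coeff Q w = 0" by (auto simp: e_coeff_def)
      then show ?thesis using 1 3 by simp
    next
      case True
      have "card {B \<in> Q. w x \<in> w ` B} = c"
        unfolding c_def using card_blocks_meeting_color[OF Q _ True] insert by auto
      moreover have "card Q = card {B \<in> Q. w x \<in> w ` B} + card {B \<in> Q. w x \<notin> w ` B}"
        using fin by (subst card_Un_disjoint[symmetric]) (auto intro: arg_cong[where f = card])
      ultimately have eq: "of_nat (card {B \<in> Q. w x \<notin> w ` B}) = of_nat (Suc l) - (of_nat c :: rat)"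
        using l by simp
      show ?thesis unfolding 1 3 eq by (simp add: l algebra_simps)
    qed
  qed
  have "(\<Sum>P | partition_on (insert x A) P. ?f P) = (\<Sum>Q | partition_on A Q. - of_nat c * ?f Q)"
    unfolding sum_partitions_insert[OF insert(1,3)] using step by (intro sum.cong) auto
  also have "\<dots> = - of_nat c * (\<Sum>Q | partition_on A Q. ?f Q)" by (simp add: sum_distrib_left)
  also have "\<dots> = - of_nat c * (if \<forall>x\<in>A. \<forall>y\<in>A. w x = w y then (-1) ^ (card A - 1) * fact (card A - 1) else 0)"
    by (subst insert.IH) simp
  also have "\<dots> = (if \<forall>y\<in>insert x A. \<forall>z\<in>insert x A. w y = w z
       then (-1) ^ (card (insert x A) - 1) * fact (card (insert x A) - 1) else 0)"
  proof (cases "\<forall>y\<in>insert x A. \<forall>z\<in>insert x A. w y = w z")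
    case True
    then have "{y \<in> A. w y = w x} = A" by auto
    then have "c = card A" by (simp add: c_def)
    moreover obtain m where "card A = Suc m" using insert(1,2) by (metis card_0_eq not0_implies_Suc)
    moreover have const: "\<forall>x\<in>A. \<forall>y\<in>A. w x = w y" using True by blast
    ultimately show ?thesis
      unfolding if_P[OF True] if_P[OF const] using insert(1,3) by (simp add: algebra_simps)
  next
    case False
    show ?thesis
    proof (cases "\<forall>x\<in>A. \<forall>y\<in>A. w x = w y")
      case True
      have "w y \<noteq> w x" if "y \<in> A" for y
      proof
        assume "w y = w x"
        then have "w z = w x" if "z \<in> insert x A" for z
          using True \<open>y \<in> A\<close> \<open>w y = w x\<close> that by (metis insertE)
        then show False using False by metis
      qed
      then have "{y \<in> A. w y = w x} = {}" by blast
      then have "c = 0" unfolding c_def by (metis card.empty)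
      then show ?thesis unfolding if_not_P[OF False] by simp
    next
      case not_const: False
      show ?thesis unfolding if_not_P[OF False] if_not_P[OF not_const] by simp
    qed
  qed
  finally show ?case .
qed

text \<open>The coefficient of \<open>e\<^sub>P\<close> in \<open>(-1)^(card C - 1) p\<^sub>C\<close>; \<open>refinement_coeff\<close> is the corresponding
  coefficient for a product of power sums over the blocks of a partition.\<close>

definition p_to_e :: "'a set \<Rightarrow> 'a set set \<Rightarrow> rat" where
  "p_to_e C P = (-1) ^ (card P - 1) * fact (card P - 1) / fact (card C - 1)"

definition refinement_coeff :: "'a set set \<Rightarrow> 'a set set \<Rightarrow> rat" where
  "refinement_coeff R P =
     (\<Sum>f | f \<in> (\<Pi>\<^sub>E C\<in>R. {Q. partition_on C Q}) \<and> \<Union>(f ` R) = P. \<Prod>C\<in>R. p_to_e C (f C))"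

lemma partition_on_Union_family:
  assumes "partition_on A R" "\<And>C. C \<in> R \<Longrightarrow> partition_on C (f C)"
  shows "partition_on A (\<Union>(f ` R))"
proof (rule partition_onI)
  have "\<Union>(f C) = C" if "C \<in> R" for C using assms(2)[OF that] by (simp add: partition_on_def)
  then have "(\<Union>C\<in>R. \<Union>(f C)) = \<Union>R" by simp
  moreover have "\<Union>(\<Union>(f ` R)) = (\<Union>C\<in>R. \<Union>(f C))" by blast
  ultimately have "\<Union>(\<Union>(f ` R)) = \<Union>R" by simp
  then show "\<Union>(\<Union>(f ` R)) = A" using assms(1) by (simp add: partition_on_def)
  show "{} \<notin> \<Union>(f ` R)" using assms(2) by (auto simp: partition_on_def)
  fix p q assume "p \<in> \<Union>(f ` R)" "q \<in> \<Union>(f ` R)" "p \<noteq> q"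
  then obtain C C' where *: "C \<in> R" "C' \<in> R" "p \<in> f C" "q \<in> f C'" by auto
  show "disjnt p q"
  proof (cases "C = C'")
    case True
    then show ?thesis using assms(2)[OF *(1)] * \<open>p \<noteq> q\<close>
      by (auto simp: partition_on_def disjoint_def disjnt_def)
  next
    case False
    then have "C \<inter> C' = {}" using assms(1) * by (auto simp: partition_on_def disjoint_def)
    moreover have "p \<subseteq> C" "q \<subseteq> C'" using assms(2) * partition_on_Diff_block(2) by metis+
    ultimately show ?thesis by (auto simp: disjnt_def)
  qed
qed

lemma finite_block: "partition_on A P \<Longrightarrow> finite A \<Longrightarrow> B \<in> P \<Longrightarrow> finite B"
  by (metis partition_on_Diff_block(2) finite_subset)

lemma e_coeff_Union_family:
  "finite R \<Longrightarrow> e_coeff (\<Union>(f ` R)) w = (\<Prod>C\<in>R. e_coeff (f C) w)"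
proof (induction R rule: finite_induct)
  case (insert C R)
  have "e_coeff (f C \<union> \<Union>(f ` R)) w = e_coeff (f C) w * e_coeff (\<Union>(f ` R)) w"
    by (simp add: e_coeff_def ball_Un)
  then show ?case using insert by simp
qed (simp add: e_coeff_def)

text \<open>Every factor is expanded by \<open>power_sum_eq_sum_e_coeff\<close> and the product is
  multiplied out. A choice of a partition of each block of \<open>R\<close> glues to a partition of
  \<open>A\<close>, on which \<open>e_coeff\<close> is multiplicative; grouping the choices by the
  glued partition produces \<open>refinement_coeff\<close>.\<close>

lemma signed_power_sum_eq_sum_refinements:
  assumes "finite A" "partition_on A R"
  shows "(\<Prod>C\<in>R. (-1) ^ (card C - 1) * (if \<forall>x\<in>C. \<forall>y\<in>C. w x = w y then 1 else 0)) =
         (\<Sum>P | partition_on A P. refinement_coeff R P * e_coeff P w)"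
proof -
  have fin: "finite R" "\<And>C. C \<in> R \<Longrightarrow> finite C"
    using assms by (auto intro: finite_block partition_on_finiteD)
  have finF: "finite (\<Pi>\<^sub>E C\<in>R. {Q. partition_on C Q})"
    using fin by (intro finite_PiE) auto
  have "(\<Prod>C\<in>R. (-1) ^ (card C - 1) * (if \<forall>x\<in>C. \<forall>y\<in>C. w x = w y then 1 else 0)) =
        (\<Prod>C\<in>R. \<Sum>Q | partition_on C Q. p_to_e C Q * e_coeff Q w)"
  proof (rule prod.cong[OF refl])
    fix C assume "C \<in> R"
    then have C: "finite C" "C \<noteq> {}" using fin assms by (auto simp: partition_on_def)
    have "(\<Sum>Q | partition_on C Q. p_to_e C Q * e_coeff Q w) =
      (\<Sum>Q | partition_on C Q. (-1) ^ (card Q - 1) * fact (card Q - 1) * e_coeff Q w) / fact (card C - 1)"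
      by (simp add: p_to_e_def sum_divide_distrib)
    moreover have "a * (if \<phi> then 1 else 0) = (if \<phi> then a * fact m else 0) / fact m" for a :: rat and \<phi> m
      by simp
    ultimately show "(-1) ^ (card C - 1) * (if \<forall>x\<in>C. \<forall>y\<in>C. w x = w y then 1 else 0) =
      (\<Sum>Q | partition_on C Q. p_to_e C Q * e_coeff Q w)"
      unfolding power_sum_eq_sum_e_coeff[OF C] by (simp only:)
  qed
  also have "\<dots> = (\<Sum>f\<in>(\<Pi>\<^sub>E C\<in>R. {Q. partition_on C Q}). \<Prod>C\<in>R. p_to_e C (f C) * e_coeff (f C) w)"
    using fin by (intro prod_sum_PiE) auto
  also have "\<dots> = (\<Sum>f\<in>(\<Pi>\<^sub>E C\<in>R. {Q. partition_on C Q}).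
      (\<Prod>C\<in>R. p_to_e C (f C)) * e_coeff (\<Union>(f ` R)) w)"
    using fin by (simp add: e_coeff_Union_family prod.distrib)
  also have "\<dots> = (\<Sum>P | partition_on A P.
      \<Sum>f | f \<in> (\<Pi>\<^sub>E C\<in>R. {Q. partition_on C Q}) \<and> \<Union>(f ` R) = P.
        (\<Prod>C\<in>R. p_to_e C (f C)) * e_coeff (\<Union>(f ` R)) w)"
  proof (rule sum.group[symmetric])
    show "(\<lambda>f. \<Union>(f ` R)) ` (\<Pi>\<^sub>E C\<in>R. {Q. partition_on C Q}) \<subseteq> {P. partition_on A P}"
    proof clarify
      fix f assume "f \<in> (\<Pi>\<^sub>E C\<in>R. {Q. partition_on C Q})"
      then show "partition_on A (\<Union>(f ` R))"
        by (intro partition_on_Union_family[OF assms(2)]) auto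
    qed
  qed (use finF assms in auto)
  also have "\<dots> = (\<Sum>P | partition_on A P. refinement_coeff R P * e_coeff P w)"
    unfolding refinement_coeff_def by (intro sum.cong) (auto simp: sum_distrib_right)
  finally show ?thesis .
qed

section \<open>Linear independence of the elementary symmetric functions\<close>

text \<open>The value of \<open>e\<^sub>P\<close> at the coloring of kernel \<open>Q\<close> tells whether \<open>P\<close> and \<open>Q\<close> meet in the discrete
  partition, hence is symmetric in \<open>P\<close> and \<open>Q\<close>. A linear relation between the \<open>e\<^sub>P\<close> therefore becomes, after
  expanding power sums in the \<open>e\<^sub>Q\<close>, a triangular system with respect to refinement.\<close>

definition block_label :: "nat set set \<Rightarrow> nat \<Rightarrow> nat" where
  "block_label P i = Min (\<Union>{C \<in> P. i \<in> C})"

lemma partition_on_Union_containing: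
  assumes "partition_on A P" "B \<in> P" "i \<in> B"
  shows "\<Union>{C \<in> P. i \<in> C} = B"
proof -
  have "{C \<in> P. i \<in> C} = {B}" using assms by (auto simp: partition_on_def disjoint_def)
  then show ?thesis by simp
qed

lemma block_label_eq_iff:
  assumes "partition_on A P" "finite A" "i \<in> A" "j \<in> A"
  shows "block_label P i = block_label P j \<longleftrightarrow> (\<exists>C\<in>P. i \<in> C \<and> j \<in> C)"
proof
  obtain B where B: "B \<in> P" "i \<in> B" using assms partition_onD1 by blast
  obtain C where C: "C \<in> P" "j \<in> C" using assms partition_onD1 by blast
  have lab: "block_label P i = Min B" "block_label P j = Min C"
    unfolding block_label_def using partition_on_Union_containing[OF assms(1)] B C by simp_all
  assume "block_label P i = block_label P j"
  moreover have "Min B \<in> B" "Min C \<in> C"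
    using finite_block[OF assms(1,2)] B C by (auto intro: Min_in)
  ultimately have "Min B \<in> B \<inter> C" using lab by simp
  then have "B = C" using B C assms(1) by (auto simp: partition_on_def disjoint_def)
  then show "\<exists>C\<in>P. i \<in> C \<and> j \<in> C" using B C by auto
next
  assume "\<exists>C\<in>P. i \<in> C \<and> j \<in> C"
  then obtain C where "C \<in> P" "i \<in> C" "j \<in> C" by auto
  then show "block_label P i = block_label P j"
    unfolding block_label_def using partition_on_Union_containing[OF assms(1)] by simp
qed

lemma e_coeff_block_label_iff:
  assumes "partition_on A P" "partition_on A Q" "finite A"
  shows "e_coeff P (block_label Q) =
    (if \<exists>i j. i \<noteq> j \<and> (\<exists>B\<in>P. i \<in> B \<and> j \<in> B) \<and> (\<exists>C\<in>Q. i \<in> C \<and> j \<in> C) then 0 else 1)"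
proof -
  have "B \<subseteq> A" if "B \<in> P" for B using that assms(1) partition_on_Diff_block(2) by metis
  then have "(\<forall>B\<in>P. inj_on (block_label Q) B) \<longleftrightarrow>
    \<not> (\<exists>i j. i \<noteq> j \<and> (\<exists>B\<in>P. i \<in> B \<and> j \<in> B) \<and> (\<exists>C\<in>Q. i \<in> C \<and> j \<in> C))"
    unfolding inj_on_def using block_label_eq_iff[OF assms(2,3)] by (meson subsetD)
  then show ?thesis unfolding e_coeff_def by simp
qed

lemma e_coeff_block_label_commute:
  assumes "partition_on A P" "partition_on A Q" "finite A"
  shows "e_coeff P (block_label Q) = e_coeff Q (block_label P)"
  unfolding e_coeff_block_label_iff[OF assms] e_coeff_block_label_iff[OF assms(2,1,3)]
  by (rule if_cong) auto

lemma prod_sign_if: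
  "finite R \<Longrightarrow> (\<Prod>C\<in>R. (-1) ^ m C * (if \<phi> C then 1 else 0)) =
     (if \<forall>C\<in>R. \<phi> C then \<Prod>C\<in>R. (-1) ^ m C else (0 :: rat))"
  by (induction rule: finite_induct) simp_all

text \<open>Let \<open>R\<close> be a coarsest partition with nonzero coefficient, that is, one with
  a maximal equivalence relation. Summing the relation over the colorings of kernel \<open>Q\<close>
  with weights \<open>refinement_coeff R Q\<close>, and using the symmetry in \<open>P\<close> and
  \<open>Q\<close>, turns each \<open>e_coeff\<close> into the signed power sum of \<open>R\<close>
  at the coloring of kernel \<open>P\<close>. That value is nonzero exactly when \<open>P\<close> is
  coarser than or equal to \<open>R\<close>, so only the term of \<open>R\<close> survives.\<close>

lemma e_coeff_linear_independent:
  fixes A :: "nat set"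
  assumes "finite A" and zero: "\<And>w. (\<Sum>P | partition_on A P. d P * e_coeff P w) = 0"
    and "partition_on A P"
  shows "d P = 0"
proof (rule ccontr)
  let ?rel = "\<lambda>P. {(i, j). \<exists>C\<in>P. i \<in> C \<and> j \<in> C} :: (nat \<times> nat) set"
  let ?q = "\<lambda>R w. \<Prod>C\<in>R. (-1) ^ (card C - 1) * (if \<forall>x\<in>C. \<forall>y\<in>C. w x = w y then 1 else 0) :: rat"
  let ?N = "{P. partition_on A P \<and> d P \<noteq> 0}"
  assume "d P \<noteq> 0"
  then have "?N \<noteq> {}" using assms(3) by blast
  moreover have "finite ?N" using finite_partitions[OF assms(1)] by (rule rev_finite_subset) auto
  ultimately have "\<exists>M\<in>?rel ` ?N. \<forall>X\<in>?rel ` ?N. M \<subseteq> X \<longrightarrow> M = X"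
    by (intro finite_has_maximal finite_imageI) simp_all
  then obtain M where M: "M \<in> ?rel ` ?N" "\<forall>X\<in>?rel ` ?N. M \<subseteq> X \<longrightarrow> M = X" by (rule bexE)
  then obtain R where R: "partition_on A R" "d R \<noteq> 0" "M = ?rel R" by (elim imageE CollectE conjE)
  have finR: "finite R" using R(1) assms(1) by (rule partition_on_finiteD)
  have q_nonzero: "?q R w \<noteq> 0 \<longleftrightarrow> (\<forall>C\<in>R. \<forall>x\<in>C. \<forall>y\<in>C. w x = w y)" for w :: "nat \<Rightarrow> nat"
  proof -
    have *: "(if \<phi> then c else 0) \<noteq> 0 \<longleftrightarrow> \<phi>" if "c \<noteq> 0" for \<phi> and c :: rat using that by simp
    have "(\<Prod>C\<in>R. (-1) ^ (card C - 1)) \<noteq> (0 :: rat)" using finR by simp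
    then show ?thesis by (subst prod_sign_if[OF finR]) (rule *)
  qed
  have const_iff: "(\<forall>C\<in>R. \<forall>x\<in>C. \<forall>y\<in>C. block_label P x = block_label P y) \<longleftrightarrow> ?rel R \<subseteq> ?rel P"
    if P: "partition_on A P" for P
  proof -
    have "C \<subseteq> A" if "C \<in> R" for C using that R(1) partition_on_Diff_block(2) by metis
    then have "(\<forall>C\<in>R. \<forall>x\<in>C. \<forall>y\<in>C. block_label P x = block_label P y) \<longleftrightarrow>
       (\<forall>C\<in>R. \<forall>x\<in>C. \<forall>y\<in>C. \<exists>B\<in>P. x \<in> B \<and> y \<in> B)"
      using block_label_eq_iff[OF P assms(1)] by (meson subsetD)
    moreover have "\<dots> \<longleftrightarrow> ?rel R \<subseteq> ?rel P" by blast
    ultimately show ?thesis by (rule trans)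
  qed
  have "0 = (\<Sum>Q | partition_on A Q. refinement_coeff R Q * (\<Sum>P | partition_on A P. d P * e_coeff P (block_label Q)))"
    using zero by simp
  also have "\<dots> = (\<Sum>P | partition_on A P. \<Sum>Q | partition_on A Q. refinement_coeff R Q * (d P * e_coeff P (block_label Q)))"
    by (subst sum.swap) (simp add: sum_distrib_left)
  also have "\<dots> = (\<Sum>P | partition_on A P. d P * (\<Sum>Q | partition_on A Q. refinement_coeff R Q * e_coeff Q (block_label P)))"
    unfolding sum_distrib_left
    by (intro sum.cong refl) (auto simp: e_coeff_block_label_commute[OF _ _ assms(1)])
  also have "\<dots> = (\<Sum>P | partition_on A P. d P * ?q R (block_label P))"
    by (intro sum.cong refl) (simp only: signed_power_sum_eq_sum_refinements[OF assms(1) R(1)])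
  also have "\<dots> = (\<Sum>P\<in>{R}. d P * ?q R (block_label P))"
  proof (rule sum.mono_neutral_right)
    show "\<forall>P\<in>{P. partition_on A P} - {R}. d P * ?q R (block_label P) = 0"
    proof
      fix P assume P: "P \<in> {P. partition_on A P} - {R}"
      then have P': "partition_on A P" by simp
      show "d P * ?q R (block_label P) = 0"
      proof (rule ccontr)
        assume nz: "d P * ?q R (block_label P) \<noteq> 0"
        have "d P \<noteq> 0" "?q R (block_label P) \<noteq> 0"
          using mult_not_zero[OF nz] by (rule conjunct1, rule conjunct2)
        then have "\<forall>C\<in>R. \<forall>x\<in>C. \<forall>y\<in>C. block_label P x = block_label P y"
          using q_nonzero by blast
        then have "M \<subseteq> ?rel P" unfolding R(3) by (rule const_iff[OF P', THEN iffD1])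
        moreover have "?rel P \<in> ?rel ` ?N" using P' \<open>d P \<noteq> 0\<close> by blast
        ultimately have "M = ?rel P" by (intro M(2)[THEN bspec, THEN mp])
        \<comment> \<open>A partition is recovered from its equivalence relation as the quotient of
          \<open>A\<close>.\<close>
        then have "A // ?rel R = A // ?rel P" unfolding R(3) by simp
        then have "R = P"
          unfolding partition_on_eq_quotient[OF R(1)] partition_on_eq_quotient[OF P'] .
        then show False using P by simp
      qed
    qed
  qed (use assms(1) R(1) in auto)
  also have "\<dots> = d R * ?q R (block_label R)"
    by (simp only: sum.insert finite.emptyI empty_iff not_False_eq_True sum.empty add_0_right)
  finally have "d R * ?q R (block_label R) = 0" by (rule sym)
  then have "?q R (block_label R) = 0" unfolding mult_eq_0_iff using R(2) by blast
  moreover have "?q R (block_label R) \<noteq> 0"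
    by (rule q_nonzero[THEN iffD2], rule const_iff[OF R(1), THEN iffD2, OF subset_refl])
  ultimately show False by contradiction
qed

section \<open>Sums over partitions and over compositions of a component\<close>

definition block_sizes :: "'a set set \<Rightarrow> nat multiset" where
  "block_sizes P = image_mset card (mset_set P)"

text \<open>\<open>composition_sum m h\<close> is the sum of \<open>(-1)^l h {#\<alpha>\<^sub>1, \<dots>, \<alpha>\<^sub>l#} / (\<alpha>\<^sub>1! \<dots> \<alpha>\<^sub>l!)\<close> over all
  compositions \<open>\<alpha>\<close> of \<open>m\<close>.\<close>

fun composition_sum :: "nat \<Rightarrow> (nat multiset \<Rightarrow> rat) \<Rightarrow> rat" where
  "composition_sum 0 h = h {#}"
| "composition_sum (Suc m) h =
     - (\<Sum>k\<le>m. composition_sum (m - k) (\<lambda>M. h (add_mset (Suc k) M)) / fact (Suc k))"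

lemma composition_sum_rec:
  "m > 0 \<Longrightarrow> composition_sum m h =
     - (\<Sum>k\<in>{1..m}. composition_sum (m - k) (\<lambda>M. h (add_mset k M)) / fact k)"
proof (cases m)
  case (Suc l)
  have "(\<Sum>k\<in>{1..Suc l}. composition_sum (Suc l - k) (\<lambda>M. h (add_mset k M)) / fact k) =
        (\<Sum>k\<le>l. composition_sum (l - k) (\<lambda>M. h (add_mset (Suc k) M)) / fact (Suc k))"
    by (rule sum.reindex_bij_witness[of _ Suc "\<lambda>k. k - 1"]) auto
  then show ?thesis using Suc by simp
qed simp

lemma sum_Pow_card:
  fixes \<phi> :: "nat \<Rightarrow> rat"
  assumes "finite A"
  shows "(\<Sum>B\<in>Pow A. \<phi> (card B)) = (\<Sum>k\<le>card A. of_nat (card A choose k) * \<phi> k)"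
proof -
  have "(\<Sum>B\<in>Pow A. \<phi> (card B)) = (\<Sum>k\<le>card A. \<Sum>B | B \<in> Pow A \<and> card B = k. \<phi> (card B))"
    using assms by (intro sum.group[symmetric]) (auto intro: card_mono)
  also have "\<dots> = (\<Sum>k\<le>card A. of_nat (card A choose k) * \<phi> k)"
  proof (rule sum.cong[OF refl])
    fix k
    have "(\<Sum>B | B \<in> Pow A \<and> card B = k. \<phi> (card B)) = (\<Sum>B | B \<subseteq> A \<and> card B = k. \<phi> k)"
      by (rule sum.cong) auto
    then show "(\<Sum>B | B \<in> Pow A \<and> card B = k. \<phi> (card B)) = of_nat (card A choose k) * \<phi> k"
      using n_subsets[OF assms, of k] by simp
  qed
  finally show ?thesis .
qed

text \<open>As \<open>j\<close> runs through \<open>A\<close>, the number of elements from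
  \<open>j\<close> upwards takes each value from 1 to \<open>card A\<close> once: a new minimum has
  the whole set above it and changes no other upper segment.\<close>

lemma sum_upper_segments:
  fixes \<phi> :: "nat \<Rightarrow> rat" and A :: "'a::linorder set"
  assumes "finite A"
  shows "(\<Sum>j\<in>A. \<phi> (card {x \<in> A. j \<le> x})) = (\<Sum>k\<in>{1..card A}. \<phi> k)"
  using assms
proof (induction rule: finite_linorder_min_induct)
  case (insert b A)
  have b: "b \<notin> A" using insert by auto
  have "{x \<in> insert b A. b \<le> x} = insert b A" using insert by (auto simp: less_imp_le)
  moreover have "{x \<in> insert b A. j \<le> x} = {x \<in> A. j \<le> x}" if "j \<in> A" for j
    using insert that by (auto simp: not_le)
  ultimately have "(\<Sum>j\<in>insert b A. \<phi> (card {x \<in> insert b A. j \<le> x})) =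
     \<phi> (card (insert b A)) + (\<Sum>j\<in>A. \<phi> (card {x \<in> A. j \<le> x}))"
    using b insert by simp
  then show ?case using b insert by simp
qed simp

lemma block_sizes_insert:
  "finite P \<Longrightarrow> B \<notin> P \<Longrightarrow> block_sizes (insert B P) = add_mset (card B) (block_sizes P)"
  by (simp add: block_sizes_def)

text \<open>The factor \<open>fact (card P)\<close> orders the blocks, and ordered set partitions
  with sizes \<alpha> are counted by the multinomial coefficient. The term of \<open>P\<close> is
  shared equally among its blocks, each in turn being the one that comes first; removing it
  reproduces the recursion of \<open>composition_sum\<close>.\<close>

lemma sum_ordered_partitions_eq_composition_sum:
  assumes "finite A"
  shows "(\<Sum>P | partition_on A P. (-1) ^ card P * fact (card P) * h (block_sizes P)) =
         fact (card A) * composition_sum (card A) h"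
  using assms
proof (induction "card A" arbitrary: A h rule: less_induct)
  case less
  show ?case
  proof (cases "A = {}")
    case True
    then show ?thesis by (simp add: partition_on_empty_eq block_sizes_def)
  next
    case False
    let ?g = "\<lambda>B Q. - ((-1) ^ card Q * fact (card Q) * h (add_mset (card B) (block_sizes Q)))"
    have "(\<Sum>P | partition_on A P. (-1) ^ card P * fact (card P) * h (block_sizes P)) =
          (\<Sum>P | partition_on A P. \<Sum>B\<in>P. ?g B (P - {B}))"
    proof (rule sum.cong[OF refl])
      fix P assume P: "P \<in> {P. partition_on A P}"
      then have fin: "finite P" and "P \<noteq> {}" using less False by (auto intro: partition_on_finiteD dest: partition_onD1)
      then obtain l where l: "card P = Suc l" by (metis card_0_eq not0_implies_Suc)
      have "?g B (P - {B}) = - ((-1) ^ l * fact l * h (block_sizes P))" if "B \<in> P" for B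
        using that fin l block_sizes_insert[of "P - {B}" B] by (simp add: insert_absorb)
      then have "(\<Sum>B\<in>P. ?g B (P - {B})) = of_nat (Suc l) * - ((-1) ^ l * fact l * h (block_sizes P))"
        using l by (simp del: of_nat_Suc)
      then show "(-1) ^ card P * fact (card P) * h (block_sizes P) = (\<Sum>B\<in>P. ?g B (P - {B}))"
        unfolding l by (simp add: algebra_simps)
    qed
    also have "\<dots> = (\<Sum>B\<in>Pow A - {{}}. \<Sum>Q | partition_on (A - B) Q. ?g B Q)"
      by (rule sum_partitions_distinguished_block[OF less(2)])
    also have "\<dots> = (\<Sum>B\<in>Pow A - {{}}. - (fact (card A - card B) *
       composition_sum (card A - card B) (\<lambda>M. h (add_mset (card B) M))))"
    proof (rule sum.cong[OF refl])
      fix B assume B: "B \<in> Pow A - {{}}"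
      then have "finite B" using less(2) finite_subset by auto
      then have c: "card (A - B) = card A - card B" using B by (simp add: card_Diff_subset)
      moreover have "card B > 0" "card B \<le> card A" using B \<open>finite B\<close> less(2) by (auto simp: card_gt_0_iff card_mono)
      ultimately have lt: "card (A - B) < card A" by simp
      show "(\<Sum>Q | partition_on (A - B) Q. ?g B Q) = - (fact (card A - card B) *
       composition_sum (card A - card B) (\<lambda>M. h (add_mset (card B) M)))"
        using less(1)[OF lt, of "\<lambda>M. h (add_mset (card B) M)"] less(2) c by (simp add: sum_negf)
    qed
    also have "\<dots> = - (\<Sum>B\<in>Pow A - {{}}. fact (card A - card B) *
       composition_sum (card A - card B) (\<lambda>M. h (add_mset (card B) M)))"
      by (simp add: sum_negf)
    also have "(\<Sum>B\<in>Pow A - {{}}. fact (card A - card B) *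
       composition_sum (card A - card B) (\<lambda>M. h (add_mset (card B) M))) =
       fact (card A) * (\<Sum>k\<in>{1..card A}. composition_sum (card A - k) (\<lambda>M. h (add_mset k M)) / fact k)"
    proof -
      \<comment> \<open>The value 0 at \<open>k = 0\<close> stands for the excluded empty block, so
        that the sum may run over all subsets and be grouped by size.\<close>
      let ?\<phi> = "\<lambda>k. if k = 0 then 0 else fact (card A - k) * composition_sum (card A - k) (\<lambda>M. h (add_mset k M))"
      have "(\<Sum>B\<in>Pow A - {{}}. fact (card A - card B) *
          composition_sum (card A - card B) (\<lambda>M. h (add_mset (card B) M))) = (\<Sum>B\<in>Pow A - {{}}. ?\<phi> (card B))"
        by (rule sum.cong) (use less(2) in \<open>auto simp: card_eq_0_iff dest: finite_subset\<close>)
      also have "\<dots> = (\<Sum>B\<in>Pow A. ?\<phi> (card B))"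
        using less(2) by (subst (2) sum.remove[of _ "{}"]) auto
      also have "\<dots> = (\<Sum>k\<le>card A. of_nat (card A choose k) * ?\<phi> k)"
        by (rule sum_Pow_card[OF less(2)])
      also have "\<dots> = (\<Sum>k\<in>{1..card A}. of_nat (card A choose k) * ?\<phi> k)"
        by (rule sum.mono_neutral_right) auto
      also have "\<dots> = (\<Sum>k\<in>{1..card A}. fact (card A) * (composition_sum (card A - k) (\<lambda>M. h (add_mset k M)) / fact k))"
        by (rule sum.cong) (auto simp: binomial_fact)
      finally show ?thesis by (simp add: sum_distrib_left)
    qed
    finally show ?thesis
      using False less(2) composition_sum_rec[of "card A" h] by (simp add: card_gt_0_iff)
  qed
qed

text \<open>A cut set of \<open>A\<close> consists of the left ends of the segments of a partition of \<open>A\<close> into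
  consecutive segments.\<close>

definition cuts :: "nat set \<Rightarrow> nat set set" where
  "cuts A = {J. J \<subseteq> A \<and> (A \<noteq> {} \<longrightarrow> Min A \<in> J)}"

text \<open>Points share a segment when equally many cuts lie at or below them. This is the counting
  used in \<open>piece\<close>, so segments of a component can be compared with pieces
  directly.\<close>

definition segments :: "nat set \<Rightarrow> nat set \<Rightarrow> nat set set" where
  "segments A J = {{u \<in> A. card {j \<in> J. j \<le> u} = card {j \<in> J. j \<le> v}} | v. v \<in> A}"

lemma finite_cuts [simp]: "finite A \<Longrightarrow> finite (cuts A)"
  by (rule finite_subset[of _ "Pow A"]) (auto simp: cuts_def)

lemma finite_segments [simp]: "finite A \<Longrightarrow> finite (segments A J)"
  by (simp add: segments_def)

lemma partition_on_segments: "partition_on A (segments A J)"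
  unfolding segments_def by (rule partition_onI) (auto simp: disjnt_def)

lemma cuts_empty [simp]: "cuts {} = {{}}"
  by (auto simp: cuts_def)

lemma segments_empty [simp]: "segments {} J = {}"
  by (simp add: segments_def)

text \<open>\<open>j\<close> is the largest cut. The smaller cuts form a cut set of the part below
  \<open>j\<close>, because that part, if nonempty, has the same minimum as \<open>A\<close>; if it
  is empty, \<open>j\<close> is the minimum and the only cut.\<close>

lemma sum_cuts_last:
  fixes f :: "nat set \<Rightarrow> 'b::comm_monoid_add"
  assumes "finite A" "A \<noteq> {}"
  shows "(\<Sum>J\<in>cuts A. f J) = (\<Sum>j\<in>A. \<Sum>J\<in>cuts {x \<in> A. x < j}. f (insert j J))"
proof -
  have Min_below: "Min {x \<in> A. x < j} = Min A" if ne: "{x \<in> A. x < j} \<noteq> {}" for j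
  proof (rule Min_eqI)
    obtain x where "x \<in> A" "x < j" using ne by auto
    then show "Min A \<in> {x \<in> A. x < j}"
      using assms by (auto intro: Min_in le_less_trans[OF Min_le])
  qed (use assms in auto)
  have "(\<Sum>J\<in>cuts A. f J) = (\<Sum>(j, J)\<in>(SIGMA j:A. cuts {x \<in> A. x < j}). f (insert j J))"
  proof (rule sum.reindex_bij_witness[of _ "\<lambda>(j, J). insert j J" "\<lambda>J. (Max J, J - {Max J})"])
    fix J assume J: "J \<in> cuts A"
    then have fin: "finite J" and ne: "J \<noteq> {}" and sub: "J \<subseteq> A" and MinJ: "Min A \<in> J"
      using assms finite_subset by (auto simp: cuts_def)
    have Max: "Max J \<in> J" using fin ne by simp
    show "(case (Max J, J - {Max J}) of (j, J) \<Rightarrow> insert j J) = J" using Max by auto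
    have less: "x < Max J" if "x \<in> J" "x \<noteq> Max J" for x
      using Max_ge[OF fin that(1)] that(2) by (rule le_neq_implies_less)
    have "J - {Max J} \<in> cuts {x \<in> A. x < Max J}"
    proof -
      have "Min {x \<in> A. x < Max J} \<in> J - {Max J}" if ne': "{x \<in> A. x < Max J} \<noteq> {}"
      proof -
        have "Min {x \<in> A. x < Max J} \<in> {x \<in> A. x < Max J}" using ne' assms by (intro Min_in) auto
        then show ?thesis using Min_below[OF ne'] MinJ by auto
      qed
      then show ?thesis using sub less unfolding cuts_def by blast
    qed
    then show "(Max J, J - {Max J}) \<in> (SIGMA j:A. cuts {x \<in> A. x < j})" using Max sub by auto
    show "(case (Max J, J - {Max J}) of (j, J) \<Rightarrow> f (insert j J)) = f J"
      using Max by (simp add: insert_absorb)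
  next
    fix b assume "b \<in> (SIGMA j:A. cuts {x \<in> A. x < j})"
    then obtain j J where b: "b = (j, J)" "j \<in> A" and J: "J \<in> cuts {x \<in> A. x < j}" by auto
    have sub: "J \<subseteq> {x \<in> A. x < j}" using J by (auto simp: cuts_def)
    then have fin: "finite J" using assms finite_subset by fastforce
    have "Max (insert j J) = j" using sub fin by (intro Max_eqI) (auto simp: less_imp_le)
    then show "(Max (case b of (j, J) \<Rightarrow> insert j J), (case b of (j, J) \<Rightarrow> insert j J) - {Max (case b of (j, J) \<Rightarrow> insert j J)}) = b"
      using b sub by auto
    have "Min A \<in> insert j J"
    proof (cases "{x \<in> A. x < j} = {}")
      case True
      then have "Min A = j" using assms b(2) by (intro Min_eqI) (auto simp: not_less)
      then show ?thesis by simp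
    next
      case False
      then show ?thesis using J Min_below by (auto simp: cuts_def)
    qed
    then show "(case b of (j, J) \<Rightarrow> insert j J) \<in> cuts A"
      using b sub by (auto simp: cuts_def)
  qed
  also have "\<dots> = (\<Sum>j\<in>A. \<Sum>J\<in>cuts {x \<in> A. x < j}. f (insert j J))"
    using assms by (subst sum.Sigma) auto
  finally show ?thesis .
qed

text \<open>Points from \<open>j\<close> upwards see all \<open>card J + 1\<close> cuts, while every
  lower point sees at most \<open>card J\<close> and does not see \<open>j\<close>.\<close>

lemma segments_insert_last:
  assumes "finite A" "j \<in> A" "J \<subseteq> {x \<in> A. x < j}"
  shows "segments A (insert j J) = insert {x \<in> A. j \<le> x} (segments {x \<in> A. x < j} J)"
proof -
  have fin: "finite J" using assms finite_subset by fastforce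
  have jJ: "j \<notin> J" using assms by auto
  have hi: "card {i \<in> insert j J. i \<le> u} = Suc (card J)" if "j \<le> u" for u
  proof -
    have "{i \<in> insert j J. i \<le> u} = insert j J" using that assms by auto
    then show ?thesis using fin jJ by simp
  qed
  have lo: "{i \<in> insert j J. i \<le> u} = {i \<in> J. i \<le> u}" if "u < j" for u
    using that by auto
  have lo_card: "card {i \<in> J. i \<le> u} \<le> card J" for u
    using fin by (intro card_mono) auto
  let ?c = "\<lambda>u. card {i \<in> insert j J. i \<le> u}"
  have 1: "{u \<in> A. ?c u = ?c v} = {x \<in> A. j \<le> x}" if "v \<in> A" "j \<le> v" for v
    using hi lo lo_card that by (metis (no_types, lifting) Suc_n_not_le_n not_le)
  have 2: "{u \<in> A. ?c u = ?c v} = {u \<in> {x \<in> A. x < j}. card {i \<in> J. i \<le> u} = card {i \<in> J. i \<le> v}}"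
    if "v \<in> A" "v < j" for v
    using hi lo lo_card that by (auto simp: Suc_n_not_le_n) (metis Suc_n_not_le_n not_le)+
  have "segments A (insert j J) =
     (\<lambda>v. {u \<in> A. ?c u = ?c v}) ` ({x \<in> A. j \<le> x} \<union> {x \<in> A. x < j})"
    unfolding segments_def by (auto simp: not_le)
  also have "\<dots> = (\<lambda>v. {x \<in> A. j \<le> x}) ` {x \<in> A. j \<le> x} \<union>
     (\<lambda>v. {u \<in> {x \<in> A. x < j}. card {i \<in> J. i \<le> u} = card {i \<in> J. i \<le> v}}) ` {x \<in> A. x < j}"
    unfolding image_Un using 1 2 by (intro arg_cong2[where f = "(\<union>)"] image_cong) auto
  also have "\<dots> = insert {x \<in> A. j \<le> x} (segments {x \<in> A. x < j} J)"
    unfolding segments_def using assms(2) by (auto simp: image_constant_conv)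
  finally show ?thesis .
qed

lemma last_segment_notin:
  assumes "j \<in> A"
  shows "{x \<in> A. j \<le> x} \<notin> segments {x \<in> A. x < j} J"
  using assms by (auto simp: segments_def)

text \<open>Splitting off the last segment is the recursion of \<open>composition_sum\<close>: by
  \<open>sum_upper_segments\<close> each size from 1 to \<open>card A\<close> occurs for exactly one
  position of the last cut.\<close>

lemma sum_cuts_eq_composition_sum:
  assumes "finite A"
  shows "(\<Sum>J\<in>cuts A. (-1) ^ card J * h (block_sizes (segments A J)) / (\<Prod>P\<in>segments A J. fact (card P))) =
         composition_sum (card A) h"
  using assms
proof (induction "card A" arbitrary: A h rule: less_induct)
  case less
  show ?case
  proof (cases "A = {}")
    case True
    then show ?thesis by (simp add: block_sizes_def)
  next
    case False
    have inner: "(\<Sum>J\<in>cuts {x \<in> A. x < j}. (-1) ^ card (insert j J) * h (block_sizes (segments A (insert j J))) /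
         (\<Prod>P\<in>segments A (insert j J). fact (card P))) =
      - (composition_sum (card A - card {x \<in> A. j \<le> x}) (\<lambda>M. h (add_mset (card {x \<in> A. j \<le> x}) M)) / fact (card {x \<in> A. j \<le> x}))"
      if j: "j \<in> A" for j
    proof -
      let ?L = "{x \<in> A. x < j}" and ?H = "{x \<in> A. j \<le> x}"
      have "card A = card ?L + card ?H" using less(2)
        by (subst card_Un_disjoint[symmetric]) (auto intro!: arg_cong[where f = card])
      moreover have "card ?H > 0" using j less(2) by (auto simp: card_gt_0_iff)
      ultimately have c: "card ?L = card A - card ?H" "card ?L < card A" by auto
      have summand: "(-1) ^ card (insert j J) * h (block_sizes (segments A (insert j J))) /
         (\<Prod>P\<in>segments A (insert j J). fact (card P)) =
         - ((-1) ^ card J * h (add_mset (card ?H) (block_sizes (segments ?L J))) /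
           (\<Prod>P\<in>segments ?L J. fact (card P))) / fact (card ?H)" if "J \<in> cuts ?L" for J
      proof -
        have sub: "J \<subseteq> ?L" using that by (auto simp: cuts_def)
        then have "finite J" "j \<notin> J" using less(2) finite_subset by fastforce+
        moreover have "?H \<notin> segments ?L J" by (rule last_segment_notin[OF j])
        ultimately show ?thesis
          unfolding segments_insert_last[OF less(2) j sub] using less(2)
          by (simp add: block_sizes_insert)
      qed
      have "(\<Sum>J\<in>cuts ?L. (-1) ^ card (insert j J) * h (block_sizes (segments A (insert j J))) /
         (\<Prod>P\<in>segments A (insert j J). fact (card P))) =
         - (\<Sum>J\<in>cuts ?L. (-1) ^ card J * h (add_mset (card ?H) (block_sizes (segments ?L J))) /
           (\<Prod>P\<in>segments ?L J. fact (card P))) / fact (card ?H)"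
        using summand by (simp add: sum_divide_distrib sum_negf)
      then show ?thesis using less(1)[of ?L "\<lambda>M. h (add_mset (card ?H) M)"] c less(2) by simp
    qed
    have "(\<Sum>J\<in>cuts A. (-1) ^ card J * h (block_sizes (segments A J)) / (\<Prod>P\<in>segments A J. fact (card P))) =
      - (\<Sum>j\<in>A. composition_sum (card A - card {x \<in> A. j \<le> x}) (\<lambda>M. h (add_mset (card {x \<in> A. j \<le> x}) M)) / fact (card {x \<in> A. j \<le> x}))"
      unfolding sum_cuts_last[OF less(2) False] using inner by (simp add: sum_negf)
    also have "\<dots> = - (\<Sum>k\<in>{1..card A}. composition_sum (card A - k) (\<lambda>M. h (add_mset k M)) / fact k)"
      using sum_upper_segments[OF less(2), of "\<lambda>k. composition_sum (card A - k) (\<lambda>M. h (add_mset k M)) / fact k"] by simp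
    finally show ?thesis
      using False less(2) composition_sum_rec[of "card A" h] by (simp add: card_gt_0_iff)
  qed
qed

section \<open>Counting labelings and stars\<close>

text \<open>At a least point of disagreement, say with \<open>f x < g x\<close>, the value
  \<open>f x\<close> is taken by \<open>g\<close> at a smaller point, where both functions agree; so
  \<open>f\<close> would take it twice.\<close>

lemma strict_mono_on_unique:
  fixes f g :: "nat \<Rightarrow> nat"
  assumes "strict_mono_on B f" "strict_mono_on B g" "f ` B = g ` B" "x \<in> B"
  shows "f x = g x"
  using \<open>x \<in> B\<close>
proof (induction x rule: less_induct)
  case (less x)
  have aux: "\<not> f' x < g' x"
    if fg: "strict_mono_on B f'" "strict_mono_on B g'" "f' ` B = g' ` B"
      and IH: "\<And>y. y < x \<Longrightarrow> y \<in> B \<Longrightarrow> f' y = g' y" for f' g' :: "nat \<Rightarrow> nat"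
  proof
    assume lt: "f' x < g' x"
    obtain y where y: "y \<in> B" "f' x = g' y" using fg(3) less(2) by blast
    then have "y < x" using lt strict_mono_on_less[OF fg(2)] less(2) by metis
    then have "f' y = f' x" using IH y by metis
    moreover have "f' y < f' x" using \<open>y < x\<close> y(1) less(2) fg(1) by (auto simp: strict_mono_on_def)
    ultimately show False by simp
  qed
  have "\<not> f x < g x" using aux[OF assms(1,2,3)] less by metis
  moreover have "\<not> g x < f x" using aux[OF assms(2,1) assms(3)[symmetric]] less by metis
  ultimately show ?case by simp
qed

lemma ex_strict_mono_bij:
  fixes A B :: "nat set"
  assumes "finite A" "finite B" "card A = card B"
  shows "\<exists>f. bij_betw f A B \<and> strict_mono_on A f"
proof -
  obtain h where h: "bij_betw h {..<card A} A" "strict_mono_on {..<card A} h"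
    using ex_bij_betw_strict_mono_card[OF assms(1)] by blast
  obtain k where k: "bij_betw k {..<card B} B" "strict_mono_on {..<card B} k"
    using ex_bij_betw_strict_mono_card[OF assms(2)] by blast
  let ?h' = "the_inv_into {..<card A} h"
  have h': "bij_betw ?h' A {..<card A}" using h(1) by (rule bij_betw_the_inv_into)
  have "bij_betw (k \<circ> ?h') A B"
    using h' k(1) assms(3) by (metis bij_betw_trans)
  moreover have "strict_mono_on A (k \<circ> ?h')"
  proof (rule strict_mono_onI)
    fix r s assume rs: "r \<in> A" "s \<in> A" "r < s"
    then have mem: "?h' r \<in> {..<card A}" "?h' s \<in> {..<card A}" using h' by (auto dest: bij_betwE)
    have "h (?h' r) = r" "h (?h' s) = s"
      using rs h(1) by (auto simp: f_the_inv_into_f_bij_betw)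
    then have "?h' r < ?h' s" using strict_mono_on_less[OF h(2) mem] rs by simp
    then show "(k \<circ> ?h') r < (k \<circ> ?h') s"
      using k(2) mem assms(3) by (auto simp: strict_mono_on_def)
  qed
  ultimately show ?thesis by blast
qed

text \<open>The target \<open>X\<close> is arbitrary because the counting induction removes a block
  together with its image. Fixing the points outside the union makes each bijection a single
  function, as with \<open>permutes\<close>.\<close>

definition increasing_bijections :: "nat set set \<Rightarrow> nat set \<Rightarrow> (nat \<Rightarrow> nat) set" where
  "increasing_bijections P X =
     {f. bij_betw f (\<Union>P) X \<and> (\<forall>x. x \<notin> \<Union>P \<longrightarrow> f x = x) \<and> (\<forall>B\<in>P. strict_mono_on B f)}"

lemma finite_increasing_bijections:
  assumes "finite (\<Union>P)" "finite X"
  shows "finite (increasing_bijections P X)"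
proof -
  have "inj_on (\<lambda>f. restrict f (\<Union>P)) (increasing_bijections P X)"
  proof (rule inj_onI)
    fix f g assume fg: "f \<in> increasing_bijections P X" "g \<in> increasing_bijections P X"
      and eq: "restrict f (\<Union>P) = restrict g (\<Union>P)"
    show "f = g"
    proof
      fix x show "f x = g x"
        using fg fun_cong[OF eq, of x] by (cases "x \<in> \<Union>P") (auto simp: increasing_bijections_def)
    qed
  qed
  moreover have "(\<lambda>f. restrict f (\<Union>P)) ` increasing_bijections P X \<subseteq> (\<Union>P) \<rightarrow>\<^sub>E X"
    by (auto simp: increasing_bijections_def bij_betw_def)
  ultimately show ?thesis
    using finite_PiE[OF assms(1)] assms(2) by (metis finite_imageD finite_subset)
qed

text \<open>This is the multinomial coefficient. The image \<open>Y\<close> of a block may be any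
  subset of \<open>X\<close> of the right size; it determines the increasing map on the block, and
  the other blocks are mapped onto \<open>X - Y\<close>.\<close>

lemma card_increasing_bijections:
  assumes "finite P" "disjoint P" "\<And>B. B \<in> P \<Longrightarrow> finite B" "finite X" "card X = card (\<Union>P)"
  shows "card (increasing_bijections P X) * (\<Prod>B\<in>P. fact (card B)) = fact (card X)"
  using assms
proof (induction P arbitrary: X rule: finite_induct)
  case empty
  then have "increasing_bijections {} X = {\<lambda>x. x}"
    by (auto simp: increasing_bijections_def bij_betw_def)
  then show ?case using empty by simp
next
  case (insert B P)
  have disjP: "disjoint P" using insert(4) by (simp add: pairwise_insert)
  have dB: "B \<inter> \<Union>P = {}" using insert(2,4) by (auto simp: disjoint_def)
  have finB: "finite B" and finU: "finite (\<Union>P)" using insert by auto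
  have cX: "card X = card B + card (\<Union>P)"
    using insert(7) card_Un_disjoint[OF finB finU dB] by simp
  let ?\<Y> = "{Y. Y \<subseteq> X \<and> card Y = card B}"
  have "\<forall>Y\<in>?\<Y>. \<exists>f. bij_betw f B Y \<and> strict_mono_on B f"
  proof
    fix Y assume "Y \<in> ?\<Y>"
    then have "finite Y" "card B = card Y" using insert(6) finite_subset by auto
    then show "\<exists>f. bij_betw f B Y \<and> strict_mono_on B f" by (rule ex_strict_mono_bij[OF finB])
  qed
  then obtain \<phi> where \<phi>: "\<And>Y. Y \<in> ?\<Y> \<Longrightarrow> bij_betw (\<phi> Y) B Y \<and> strict_mono_on B (\<phi> Y)"
    by metis
  let ?to = "\<lambda>(Y, g) x. if x \<in> B then \<phi> Y x else g x"
  \<comment> \<open>Resetting the values on \<open>B\<close> to the identity gives a member of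
    \<open>increasing_bijections P\<close>, since these fix every point outside the blocks of
    \<open>P\<close>.\<close>
  let ?from = "\<lambda>f. (f ` B, \<lambda>x. if x \<in> B then x else f x)"
  have "bij_betw ?to (SIGMA Y:?\<Y>. increasing_bijections P (X - Y)) (increasing_bijections (insert B P) X)"
  proof (rule bij_betw_byWitness[of _ ?from])
    show "\<forall>a\<in>SIGMA Y:?\<Y>. increasing_bijections P (X - Y). ?from (?to a) = a"
    proof
      fix a assume "a \<in> (SIGMA Y:?\<Y>. increasing_bijections P (X - Y))"
      then obtain Y g where a: "a = (Y, g)" and Y: "Y \<subseteq> X" "card Y = card B"
        and g: "g \<in> increasing_bijections P (X - Y)" by auto
      have "?to (Y, g) ` B = Y" using \<phi>[of Y] Y by (auto simp: bij_betw_def)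
      moreover have "g x = x" if "x \<in> B" for x
      proof -
        have "x \<notin> \<Union>P" using that dB by blast
        then show ?thesis using g by (simp add: increasing_bijections_def)
      qed
      ultimately show "?from (?to a) = a" unfolding a by (auto simp: fun_eq_iff)
    qed
    show "\<forall>f\<in>increasing_bijections (insert B P) X. ?to (?from f) = f"
    proof
      fix f assume f: "f \<in> increasing_bijections (insert B P) X"
      then have bij: "bij_betw f (B \<union> \<Union>P) X" and mono: "strict_mono_on B f"
        by (auto simp: increasing_bijections_def)
      have "card (f ` B) = card B" using bij by (intro card_image) (auto simp: bij_betw_def inj_on_def)
      moreover have "f ` B \<subseteq> X" using bij by (auto simp: bij_betw_def)
      ultimately have "f ` B \<in> ?\<Y>" by simp
      then have "\<phi> (f ` B) x = f x" if "x \<in> B" for x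
        using \<phi> strict_mono_on_unique[OF _ mono _ that] by (auto simp: bij_betw_def)
      then show "?to (?from f) = f" by (auto simp: fun_eq_iff)
    qed
    show "?to ` (SIGMA Y:?\<Y>. increasing_bijections P (X - Y)) \<subseteq> increasing_bijections (insert B P) X"
    proof (rule image_subsetI)
      fix a assume "a \<in> (SIGMA Y:?\<Y>. increasing_bijections P (X - Y))"
      then obtain Y g where a: "a = (Y, g)" and Y: "Y \<subseteq> X" "card Y = card B"
        and g: "g \<in> increasing_bijections P (X - Y)" by auto
      let ?f = "\<lambda>x. if x \<in> B then \<phi> Y x else g x"
      have "bij_betw ?f B Y" using \<phi>[of Y] Y by (simp cong: bij_betw_cong)
      moreover have "bij_betw ?f (\<Union>P) (X - Y)"
      proof -
        have "bij_betw ?f (\<Union>P) (X - Y) \<longleftrightarrow> bij_betw g (\<Union>P) (X - Y)"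
          using dB by (intro bij_betw_cong) auto
        then show ?thesis using g by (simp add: increasing_bijections_def)
      qed
      ultimately have "bij_betw ?f (B \<union> \<Union>P) (Y \<union> (X - Y))" by (rule bij_betw_combine) auto
      moreover have "Y \<union> (X - Y) = X" using Y by auto
      moreover have "strict_mono_on B ?f" using \<phi>[of Y] Y by (auto simp: strict_mono_on_def)
      moreover have "strict_mono_on C ?f" if "C \<in> P" for C
      proof -
        have "C \<inter> B = {}" using dB that by auto
        then show ?thesis using g that by (auto simp: strict_mono_on_def increasing_bijections_def)
      qed
      moreover have "?f x = x" if "x \<notin> B \<union> \<Union>P" for x
        using g that by (simp add: increasing_bijections_def)
      ultimately have "?f \<in> increasing_bijections (insert B P) X"
        by (simp add: increasing_bijections_def)
      then show "?to a \<in> increasing_bijections (insert B P) X" unfolding a by simp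
    qed
    show "?from ` increasing_bijections (insert B P) X \<subseteq> (SIGMA Y:?\<Y>. increasing_bijections P (X - Y))"
    proof (rule image_subsetI)
      fix f assume f: "f \<in> increasing_bijections (insert B P) X"
      then have bij: "bij_betw f (B \<union> \<Union>P) X" by (auto simp: increasing_bijections_def)
      then have inj: "inj_on f (B \<union> \<Union>P)" and img: "f ` (B \<union> \<Union>P) = X" by (auto simp: bij_betw_def)
      have "card (f ` B) = card B" using inj by (intro card_image) (auto simp: inj_on_def)
      moreover have "f ` B \<subseteq> X" using img by auto
      moreover have "(\<lambda>x. if x \<in> B then x else f x) \<in> increasing_bijections P (X - f ` B)"
      proof -
        have "f ` \<Union>P = X - f ` B"
          using inj_on_image_Int[OF inj, of B "\<Union>P"] dB img by (auto simp: image_Un)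
        then have "bij_betw f (\<Union>P) (X - f ` B)"
          using inj_on_subset[OF inj, of "\<Union>P"] by (simp add: bij_betw_def)
        then have "bij_betw (\<lambda>x. if x \<in> B then x else f x) (\<Union>P) (X - f ` B)"
          using dB by (subst bij_betw_cong[of _ _ f]) auto
        moreover have "strict_mono_on C (\<lambda>x. if x \<in> B then x else f x)" if "C \<in> P" for C
        proof -
          have "C \<inter> B = {}" using dB that by auto
          then show ?thesis using f that by (auto simp: strict_mono_on_def increasing_bijections_def)
        qed
        ultimately show ?thesis using f by (auto simp: increasing_bijections_def)
      qed
      ultimately show "?from f \<in> (SIGMA Y:?\<Y>. increasing_bijections P (X - Y))" by simp
    qed
  qed
  then have "card (increasing_bijections (insert B P) X) =
      card (SIGMA Y:?\<Y>. increasing_bijections P (X - Y))"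
    by (rule bij_betw_same_card[symmetric])
  also have "\<dots> = (\<Sum>Y\<in>?\<Y>. card (increasing_bijections P (X - Y)))"
    using insert(6) finU by (intro card_SigmaI) (auto intro: finite_increasing_bijections)
  finally have "card (increasing_bijections (insert B P) X) * (\<Prod>C\<in>P. fact (card C)) =
      (\<Sum>Y\<in>?\<Y>. card (increasing_bijections P (X - Y)) * (\<Prod>C\<in>P. fact (card C)))"
    by (simp add: sum_distrib_right)
  also have "\<dots> = (\<Sum>Y\<in>?\<Y>. fact (card X - card B))"
  proof (rule sum.cong[OF refl])
    fix Y assume Y: "Y \<in> ?\<Y>"
    then have c: "card (X - Y) = card X - card B"
      using finite_subset[OF _ insert(6), of Y] by (simp add: card_Diff_subset)
    then have "card (X - Y) = card (\<Union>P)" using cX by simp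
    then show "card (increasing_bijections P (X - Y)) * (\<Prod>C\<in>P. fact (card C)) = fact (card X - card B)"
      using insert(3)[OF disjP insert(5), of "X - Y"] insert(6) c by simp
  qed
  also have "\<dots> = (card X choose card B) * fact (card X - card B)"
    using n_subsets[OF insert(6)] by simp
  finally show ?case
    using insert(1,2) binomial_fact_lemma[of "card B" "card X"] cX by (simp add: algebra_simps)
qed

lemma card_increasing_permutations:
  fixes A :: "nat set"
  assumes "partition_on A P" "finite A"
  shows "of_nat (card {\<delta>. \<delta> permutes A \<and> (\<forall>B\<in>P. strict_mono_on B \<delta>)}) =
     (fact (card A) / (\<Prod>B\<in>P. fact (card B)) :: rat)"
proof -
  have A: "\<Union>P = A" "finite P" using assms finite_elements by (auto simp: partition_on_def)
  have "{\<delta>. \<delta> permutes A \<and> (\<forall>B\<in>P. strict_mono_on B \<delta>)} = increasing_bijections P A"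
    unfolding increasing_bijections_def A(1)
    by (auto simp: permutes_imp_bij permutes_not_in intro: bij_imp_permutes)
  moreover have "finite B" if "B \<in> P" for B
    using that A(1) by (intro finite_subset[OF _ assms(2)]) blast
  ultimately have "card {\<delta>. \<delta> permutes A \<and> (\<forall>B\<in>P. strict_mono_on B \<delta>)} * (\<Prod>B\<in>P. fact (card B)) = fact (card A)"
    using card_increasing_bijections[of P A] A assms by (simp add: partition_on_def)
  then have "of_nat (card {\<delta>. \<delta> permutes A \<and> (\<forall>B\<in>P. strict_mono_on B \<delta>)} * (\<Prod>B\<in>P. fact (card B))) =
      (of_nat (fact (card A)) :: rat)"
    by (simp only:)
  then have "of_nat (card {\<delta>. \<delta> permutes A \<and> (\<forall>B\<in>P. strict_mono_on B \<delta>)}) * (\<Prod>B\<in>P. fact (card B)) =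
      (fact (card A) :: rat)"
    by (simp only: of_nat_mult of_nat_prod of_nat_fact)
  moreover have "(\<Prod>B\<in>P. fact (card B)) \<noteq> (0 :: rat)" using A by simp
  ultimately show ?thesis by (simp add: field_simps)
qed

lemma card_transversals:
  assumes "finite R" "disjoint R" "\<And>B. B \<in> R \<Longrightarrow> finite B"
  shows "card {S. S \<subseteq> \<Union>R \<and> (\<forall>B\<in>R. card (S \<inter> B) = 1)} = (\<Prod>B\<in>R. card B)"
proof -
  have "bij_betw (\<lambda>f. f ` R) (\<Pi>\<^sub>E B\<in>R. B) {S. S \<subseteq> \<Union>R \<and> (\<forall>B\<in>R. card (S \<inter> B) = 1)}"
  proof (rule bij_betw_byWitness[of _ "\<lambda>S. restrict (\<lambda>B. the_elem (S \<inter> B)) R"])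
    have *: "f ` R \<inter> B = {f B}" if "f \<in> (\<Pi>\<^sub>E B\<in>R. B)" "B \<in> R" for f B
    proof -
      have "C = B" if "C \<in> R" "f C \<in> B" for C
        using that \<open>f \<in> _\<close> \<open>B \<in> R\<close> assms(2) by (auto simp: disjoint_def PiE_def Pi_def)
      then show ?thesis using that by auto
    qed
    then show "\<forall>f\<in>\<Pi>\<^sub>E B\<in>R. B. restrict (\<lambda>B. the_elem (f ` R \<inter> B)) R = f"
      by (auto simp: fun_eq_iff restrict_def PiE_def extensional_def)
    have **: "S \<inter> B = {the_elem (S \<inter> B)}" if "card (S \<inter> B) = 1" for S B :: "'a set"
      using that by (metis card_1_singletonE the_elem_eq)
    show "\<forall>S\<in>{S. S \<subseteq> \<Union>R \<and> (\<forall>B\<in>R. card (S \<inter> B) = 1)}. restrict (\<lambda>B. the_elem (S \<inter> B)) R ` R = S"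
    proof clarify
      fix S assume S: "S \<subseteq> \<Union>R" "\<forall>B\<in>R. card (S \<inter> B) = 1"
      have "S = (\<Union>B\<in>R. S \<inter> B)" using S(1) by auto
      also have "\<dots> = (\<Union>B\<in>R. {the_elem (S \<inter> B)})" using S(2) ** by (intro SUP_cong) auto
      finally show "restrict (\<lambda>B. the_elem (S \<inter> B)) R ` R = S" by auto
    qed
    show "(\<lambda>f. f ` R) ` (\<Pi>\<^sub>E B\<in>R. B) \<subseteq> {S. S \<subseteq> \<Union>R \<and> (\<forall>B\<in>R. card (S \<inter> B) = 1)}"
      using * by auto
    show "(\<lambda>S. restrict (\<lambda>B. the_elem (S \<inter> B)) R) ` {S. S \<subseteq> \<Union>R \<and> (\<forall>B\<in>R. card (S \<inter> B) = 1)} \<subseteq> (\<Pi>\<^sub>E B\<in>R. B)"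
    proof (rule image_subsetI)
      fix S assume "S \<in> {S. S \<subseteq> \<Union>R \<and> (\<forall>B\<in>R. card (S \<inter> B) = 1)}"
      then have "the_elem (S \<inter> B) \<in> B" if "B \<in> R" for B
        using that **[of S B] by auto
      then show "restrict (\<lambda>B. the_elem (S \<inter> B)) R \<in> (\<Pi>\<^sub>E B\<in>R. B)" by auto
    qed
  qed
  then have "card {S. S \<subseteq> \<Union>R \<and> (\<forall>B\<in>R. card (S \<inter> B) = 1)} = card (\<Pi>\<^sub>E B\<in>R. B)"
    by (rule bij_betw_same_card[symmetric])
  then show ?thesis using card_PiE[OF assms(1)] by simp
qed

section \<open>Weighted sums over product families\<close>

lemma sum_PiE_insert:
  fixes h :: "('i \<Rightarrow> 'b) \<Rightarrow> 'c::comm_monoid_add"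
  assumes "finite I" "i \<notin> I" "finite (A i)" "\<And>j. j \<in> I \<Longrightarrow> finite (A j)"
  shows "(\<Sum>f\<in>Pi\<^sub>E (insert i I) A. h f) = (\<Sum>x\<in>A i. \<Sum>f\<in>Pi\<^sub>E I A. h (f(i := x)))"
proof -
  have "(\<Sum>f\<in>Pi\<^sub>E (insert i I) A. h f) = (\<Sum>(x, f)\<in>A i \<times> Pi\<^sub>E I A. h (f(i := x)))"
    unfolding PiE_insert_eq using inj_combinator[OF assms(2), of A]
    by (subst sum.reindex) (auto simp: case_prod_unfold)
  then show ?thesis using assms by (simp add: sum.cartesian_product)
qed

text \<open>As \<open>g\<close> is arbitrary, the last hypothesis says that \<open>s i\<close> and
  \<open>t i\<close> have the same weighted distribution for each index. The joint distributions
  then coincide too, as for independent variables; \<open>G\<close> need not factor over the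
  indices.\<close>

lemma sum_PiE_transfer:
  fixes p :: "'i \<Rightarrow> 'a \<Rightarrow> rat" and q :: "'i \<Rightarrow> 'b \<Rightarrow> rat" and s :: "'i \<Rightarrow> 'a \<Rightarrow> 't"
  assumes "finite I" "\<And>i. i \<in> I \<Longrightarrow> finite (A i)" "\<And>i. i \<in> I \<Longrightarrow> finite (B i)"
    and "\<And>i g. i \<in> I \<Longrightarrow> (\<Sum>x\<in>A i. p i x * g (s i x)) = (\<Sum>y\<in>B i. q i y * g (t i y))"
  shows "(\<Sum>f\<in>Pi\<^sub>E I A. (\<Prod>i\<in>I. p i (f i)) * G (restrict (\<lambda>i. s i (f i)) I)) =
         (\<Sum>f\<in>Pi\<^sub>E I B. (\<Prod>i\<in>I. q i (f i)) * G (restrict (\<lambda>i. t i (f i)) I))"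
  using assms
proof (induction I arbitrary: G rule: finite_induct)
  case (insert i I)
  have upd: "restrict (\<lambda>j. u j ((f(i := x)) j)) (insert i I) = (restrict (\<lambda>j. u j (f j)) I)(i := u i x)"
    for f :: "'i \<Rightarrow> 'd" and x and u :: "'i \<Rightarrow> 'd \<Rightarrow> 't"
    using insert(2) by (auto simp: fun_eq_iff)
  have pr: "(\<Prod>j\<in>insert i I. r j ((f(i := x)) j)) = r i x * (\<Prod>j\<in>I. r j (f j))"
    for f :: "'i \<Rightarrow> 'd" and x and r :: "'i \<Rightarrow> 'd \<Rightarrow> rat"
  proof -
    have "(\<Prod>j\<in>I. r j ((f(i := x)) j)) = (\<Prod>j\<in>I. r j (f j))"
      using insert(2) by (intro prod.cong) auto
    then show ?thesis using insert(1,2) by simp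
  qed
  have IH: "(\<Sum>f\<in>Pi\<^sub>E I A. (\<Prod>j\<in>I. p j (f j)) * G ((restrict (\<lambda>j. s j (f j)) I)(i := y))) =
            (\<Sum>f\<in>Pi\<^sub>E I B. (\<Prod>j\<in>I. q j (f j)) * G ((restrict (\<lambda>j. t j (f j)) I)(i := y)))" for y
    by (rule insert(3)[of "\<lambda>F. G (F(i := y))"]) (intro insert(4-6) insertI2; assumption)+
  have "(\<Sum>f\<in>Pi\<^sub>E (insert i I) A. (\<Prod>j\<in>insert i I. p j (f j)) * G (restrict (\<lambda>j. s j (f j)) (insert i I))) =
        (\<Sum>x\<in>A i. p i x * (\<Sum>f\<in>Pi\<^sub>E I A. (\<Prod>j\<in>I. p j (f j)) * G ((restrict (\<lambda>j. s j (f j)) I)(i := s i x))))"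
    using insert(4) by (subst sum_PiE_insert[OF insert(1,2)]) (simp_all only: upd pr sum_distrib_left mult.assoc insertI1 insertI2)
  also have "\<dots> = (\<Sum>x\<in>A i. p i x * (\<Sum>f\<in>Pi\<^sub>E I B. (\<Prod>j\<in>I. q j (f j)) * G ((restrict (\<lambda>j. t j (f j)) I)(i := s i x))))"
    by (simp only: IH)
  \<comment> \<open>The hypothesis for \<open>i\<close> is used with the whole inner sum, as a
    function of the value at \<open>i\<close>, in the role of \<open>g\<close>.\<close>
  also have "\<dots> = (\<Sum>y\<in>B i. q i y * (\<Sum>f\<in>Pi\<^sub>E I B. (\<Prod>j\<in>I. q j (f j)) * G ((restrict (\<lambda>j. t j (f j)) I)(i := t i y))))"
    by (rule insert(6)) simp
  also have "\<dots> = (\<Sum>f\<in>Pi\<^sub>E (insert i I) B. (\<Prod>j\<in>insert i I. q j (f j)) * G (restrict (\<lambda>j. t j (f j)) (insert i I)))"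
    using insert(5) by (subst sum_PiE_insert[OF insert(1,2)]) (simp_all only: upd pr sum_distrib_left mult.assoc insertI1 insertI2)
  finally show ?case .
qed simp

section \<open>Arc diagrams\<close>

lemma arc_diagram_less: "D \<in> arc_diagrams n a \<Longrightarrow> (i, j) \<in> D \<Longrightarrow> 1 \<le> i \<and> i < j \<and> j \<le> n"
  by (auto simp: arc_diagrams_def)

lemma arc_diagram_unique: "D \<in> arc_diagrams n a \<Longrightarrow> (i, j) \<in> D \<Longrightarrow> (i', j) \<in> D \<Longrightarrow> i = i'"
  unfolding arc_diagrams_def by blast

lemma finite_arc_diagrams: "finite (arc_diagrams n a)"
  by (rule finite_subset[of _ "Pow ({1..n} \<times> {1..n})"]) (force simp: arc_diagrams_def)+

lemma finite_arc_diagram: "D \<in> arc_diagrams n a \<Longrightarrow> finite D"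
  by (rule finite_subset[of _ "{1..n} \<times> {1..n}"]) (force simp: arc_diagrams_def)+

lemma comp_eqI:
  assumes "u \<in> comp n D v"
  shows "comp n D u = comp n D v"
proof -
  have "sym ((D \<union> D\<inverse>)\<^sup>*)" by (intro sym_rtrancl sym_Un_converse)
  moreover have "(v, u) \<in> (D \<union> D\<inverse>)\<^sup>*" using assms by (simp add: comp_def)
  ultimately have "(u, x) \<in> (D \<union> D\<inverse>)\<^sup>* \<longleftrightarrow> (v, x) \<in> (D \<union> D\<inverse>)\<^sup>*" for x
    by (meson rtrancl_trans symD)
  then show ?thesis by (simp add: comp_def)
qed

lemma comp_self: "v \<in> {1..n} \<Longrightarrow> v \<in> comp n D v"
  by (simp add: comp_def)

lemma comp_subset: "comp n D v \<subseteq> {1..n}"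
  by (auto simp: comp_def)

lemma partition_on_comps: "partition_on {1..n} (comp n D ` {1..n})"
proof (rule partition_onI)
  show "\<Union>(comp n D ` {1..n}) = {1..n}" using comp_self comp_subset by fast
  show "{} \<notin> comp n D ` {1..n}" using comp_self by fastforce
  fix p q assume "p \<in> comp n D ` {1..n}" "q \<in> comp n D ` {1..n}" "p \<noteq> q"
  then show "disjnt p q" unfolding disjnt_iff by (metis comp_eqI imageE)
qed

lemma comp_eq_block: "C \<in> comp n D ` {1..n} \<Longrightarrow> v \<in> C \<Longrightarrow> comp n D v = C"
  using comp_eqI by fastforce

lemma comp_block_finite: "C \<in> comp n D ` {1..n} \<Longrightarrow> finite C"
  using comp_subset finite_subset[OF _ finite_atLeastAtMost] by (metis imageE)

lemma comp_block_nonempty: "C \<in> comp n D ` {1..n} \<Longrightarrow> C \<noteq> {}"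
  using comp_self by (metis emptyE imageE)

text \<open>Every vertex has at most one incoming arc and \<open>v\<close> has none. When the
  undirected path steps back along an arc into \<open>y\<close>, the last arc of the directed path
  to \<open>y\<close> is that same arc, so the directed path already visits the new vertex.\<close>

lemma root_reaches:
  assumes "D \<in> arc_diagrams n a" "v \<notin> snd ` D" "(v, u) \<in> (D \<union> D\<inverse>)\<^sup>*"
  shows "(v, u) \<in> D\<^sup>*"
  using assms(3)
proof (induction rule: rtrancl_induct)
  case (step y z)
  show ?case
  proof (cases "(y, z) \<in> D")
    case True
    then show ?thesis using step by (meson rtrancl_into_rtrancl)
  next
    case False
    then have zy: "(z, y) \<in> D" using step by auto
    then have "v \<noteq> y" using assms(2) by force
    then obtain x where "(v, x) \<in> D\<^sup>*" "(x, y) \<in> D" using step.IH by (meson rtranclE)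
    then show ?thesis using arc_diagram_unique[OF assms(1) zy] by simp
  qed
qed simp

text \<open>A vertex without incoming arc reaches its whole component along arcs going to the right,
  so it is the minimum. Hence the arcs of a component correspond to its vertices other than the
  minimum, which is what lets tic marks be encoded as cuts.\<close>

lemma right_ends_in_comp:
  assumes D: "D \<in> arc_diagrams n a" and C: "C \<in> comp n D ` {1..n}"
  shows "C \<inter> snd ` D = C - {Min C}"
proof -
  have fin: "finite C" and ne: "C \<noteq> {}" using comp_block_finite comp_block_nonempty C by simp_all
  then have Min: "Min C \<in> C" by simp
  have "v = Min C" if v: "v \<in> C" "v \<notin> snd ` D" for v
  proof -
    have "v \<le> u" if "u \<in> C" for u
    proof -
      have "(v, u) \<in> (D \<union> D\<inverse>)\<^sup>*" using comp_eq_block[OF C v(1)] that by (auto simp: comp_def)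
      from root_reaches[OF D v(2) this] show "v \<le> u"
        by (induction rule: rtrancl_induct) (auto dest: arc_diagram_less[OF D])
    qed
    then show ?thesis using fin v(1) by (intro Min_eqI[symmetric]) auto
  qed
  then have "C - {Min C} \<subseteq> snd ` D" by blast
  moreover have "Min C \<notin> snd ` D"
  proof
    assume "Min C \<in> snd ` D"
    then obtain i where i: "(i, Min C) \<in> D" by auto
    then have "1 \<le> i" "i < Min C" "i \<le> n" using arc_diagram_less[OF D i] by auto
    moreover have "i \<in> comp n D (Min C)" using i calculation by (auto simp: comp_def)
    then have "i \<in> C" using comp_eq_block[OF C Min] by simp
    ultimately show False using fin by (meson Min_le not_le)
  qed
  ultimately show ?thesis by blast
qed

lemma card_arcs_by_component:
  assumes D: "D \<in> arc_diagrams n a" and T: "T \<subseteq> D"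
  shows "card T = (\<Sum>C\<in>comp n D ` {1..n}. card (C \<inter> snd ` T))"
proof -
  let ?\<C> = "comp n D ` {1..n}"
  have "inj_on snd D"
    by (rule inj_onI) (metis arc_diagram_unique[OF D] prod.collapse)
  then have "card T = card (snd ` T)" using T by (metis card_image inj_on_subset)
  also have "snd ` T = (\<Union>C\<in>?\<C>. C \<inter> snd ` T)"
  proof -
    have "snd ` D \<subseteq> {1..n}" using arc_diagram_less[OF D] by fastforce
    then have "snd ` T \<subseteq> {1..n}" using image_mono[OF T, of snd] by (rule order.trans[rotated])
    then have "snd ` T \<subseteq> \<Union>?\<C>" unfolding partition_onD1[OF partition_on_comps, symmetric] .
    then show ?thesis by blast
  qed
  also have "card \<dots> = (\<Sum>C\<in>?\<C>. card (C \<inter> snd ` T))"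
    using finite_subset[OF T finite_arc_diagram[OF D]] partition_onD2[OF partition_on_comps, of n D]
    by (intro card_UN_disjoint) (auto simp: disjoint_def)
  finally show ?thesis .
qed

lemma card_arc_diagram:
  assumes D: "D \<in> arc_diagrams n a"
  shows "card D = (\<Sum>C\<in>comp n D ` {1..n}. card C - 1)"
  unfolding card_arcs_by_component[OF D order_refl]
proof (rule sum.cong[OF refl])
  fix C assume C: "C \<in> comp n D ` {1..n}"
  then have "finite C" "C \<noteq> {}" using comp_block_finite comp_block_nonempty by simp_all
  then show "card (C \<inter> snd ` D) = card C - 1"
    unfolding right_ends_in_comp[OF D C] by simp
qed

lemma constant_on_arcs_iff:
  assumes D: "D \<in> arc_diagrams n a"
  shows "(\<forall>(i, j)\<in>D. w i = w j) \<longleftrightarrow> (\<forall>C\<in>comp n D ` {1..n}. \<forall>x\<in>C. \<forall>y\<in>C. w x = w y)"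
proof
  assume const: "\<forall>(i, j)\<in>D. w i = w j"
  have eq: "w v = w u" if "(v, u) \<in> (D \<union> D\<inverse>)\<^sup>*" for v u
    using that
  proof (induction rule: rtrancl_induct)
    case (step y z)
    then have "w y = w z" using const by (metis (mono_tags, lifting) Un_iff case_prodD converseD)
    then show ?case using step by simp
  qed simp
  show "\<forall>C\<in>comp n D ` {1..n}. \<forall>x\<in>C. \<forall>y\<in>C. w x = w y"
  proof (intro ballI)
    fix C x y assume "C \<in> comp n D ` {1..n}" "x \<in> C" "y \<in> C"
    then have "y \<in> comp n D x" using comp_eq_block by metis
    then show "w x = w y" using eq by (simp add: comp_def)
  qed
next
  assume const: "\<forall>C\<in>comp n D ` {1..n}. \<forall>x\<in>C. \<forall>y\<in>C. w x = w y"
  show "\<forall>(i, j)\<in>D. w i = w j"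
  proof clarify
    fix i j assume ij: "(i, j) \<in> D"
    then have "i \<in> {1..n}" "j \<in> {1..n}" using arc_diagram_less[OF D ij] by auto
    moreover have "j \<in> comp n D i" using ij calculation by (auto simp: comp_def)
    ultimately show "w i = w j" using const comp_self by blast
  qed
qed

section \<open>The broken-circuit expansion of Y\<close>

lemma arc_diagrams_iff_adj:
  "D \<in> arc_diagrams n a \<longleftrightarrow> (\<forall>(i, j)\<in>D. 1 \<le> i \<and> i < j \<and> j \<le> n \<and> uig_adj n a i j) \<and>
     (\<forall>i i' j. (i, j) \<in> D \<longrightarrow> (i', j) \<in> D \<longrightarrow> i = i')"
  unfolding arc_diagrams_def uig_adj_def by fast

text \<open>The interval that contains \<open>i\<close> and \<open>j\<close> contains everything
  between them. This is what makes the left neighbor used in the sign-reversing involution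
  unique.\<close>

lemma uig_adj_between: "uig_adj n a i j \<Longrightarrow> i < i' \<Longrightarrow> i' < j \<Longrightarrow> uig_adj n a i i'"
  by (auto simp: uig_adj_def intro!: bexI)

lemma uig_adj_sym: "uig_adj n a i j \<longleftrightarrow> uig_adj n a j i"
  by (auto simp: uig_adj_def)

text \<open>Arc diagrams are the sets of edges without broken circuits. If a coloring \<open>w\<close> is not proper,
  let \<open>j\<close> be the first vertex with a left neighbor of the same color; that neighbor \<open>i\<close> is unique,
  and toggling the arc \<open>(i, j)\<close> is a sign-reversing involution.\<close>

lemma Y_coeff_eq_sum_arc_diagrams:
  "Y_coeff (uig_adj n a) n w =
     (\<Sum>D\<in>arc_diagrams n a. (-1) ^ card D * (if \<forall>(i, j)\<in>D. w i = w j then 1 else 0))"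
proof -
  define S where "S = {D \<in> arc_diagrams n a. \<forall>(i, j)\<in>D. w i = w j}"
  have finS: "finite S" unfolding S_def using finite_arc_diagrams by simp
  have "(\<Sum>D\<in>arc_diagrams n a. (-1) ^ card D * (if \<forall>(i, j)\<in>D. w i = w j then 1 else 0)) =
        (\<Sum>D\<in>S. (-1) ^ card D :: rat)"
    unfolding S_def using finite_arc_diagrams
    by (intro sum.mono_neutral_cong_right) auto
  also have "\<dots> = Y_coeff (uig_adj n a) n w"
  proof (cases "\<forall>i\<in>{1..n}. \<forall>j\<in>{1..n}. uig_adj n a i j \<longrightarrow> w i \<noteq> w j")
    case True
    have "D = {}" if "D \<in> S" for D
    proof (rule ccontr)
      assume "D \<noteq> {}"
      then obtain i j where "(i, j) \<in> D" by auto
      then have "1 \<le> i \<and> i < j \<and> j \<le> n \<and> uig_adj n a i j" "w i = w j"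
        using that unfolding S_def arc_diagrams_iff_adj by auto
      then show False using True by simp
    qed
    moreover have "{} \<in> S" by (simp add: S_def arc_diagrams_iff_adj)
    ultimately have "S = {{}}" by auto
    then show ?thesis using True by (simp add: Y_coeff_def)
  next
    case False
    let ?bad = "\<lambda>i j. 1 \<le> i \<and> i < j \<and> j \<le> n \<and> uig_adj n a i j \<and> w i = w j"
    have "\<exists>j i. ?bad i j"
    proof -
      obtain i j where *: "i \<in> {1..n}" "j \<in> {1..n}" "uig_adj n a i j" "w i = w j" using False by auto
      then have "i \<noteq> j" by (simp add: uig_adj_def)
      then consider "i < j" | "j < i" by linarith
      then show ?thesis
      proof cases
        case 1
        then have "?bad i j" using * by simp
        then show ?thesis by blast
      next
        case 2
        then have "?bad j i" using * uig_adj_sym by simp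
        then show ?thesis by blast
      qed
    qed
    then obtain j where ex: "\<exists>i. ?bad i j" and least: "\<And>j'. j' < j \<Longrightarrow> \<not> (\<exists>i. ?bad i j')"
      using exists_least_iff[of "\<lambda>j. \<exists>i. ?bad i j"] by blast
    obtain i where i: "?bad i j" using ex by blast
    \<comment> \<open>Of two such neighbors of \<open>j\<close>, the smaller one is adjacent to the
      larger one and has the same color, so the larger one contradicts the choice of
      \<open>j\<close>.\<close>
    have uniq: "i' = i" if "?bad i' j" for i'
    proof (rule ccontr)
      assume "i' \<noteq> i"
      then consider "i' < i" | "i < i'" by linarith
      then show False
      proof cases
        case 1
        then have "?bad i' i" using that i uig_adj_between[of n a i' j i] by auto
        then show False using least[of i] i by blast
      next
        case 2
        then have "?bad i i'" using that i uig_adj_between[of n a i j i'] by auto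
        then show False using least[of i'] that by blast
      qed
    qed
    define toggle where "toggle D = (if (i, j) \<in> D then D - {(i, j)} else insert (i, j) D)" for D
    have toggle_S: "toggle D \<in> S" if "D \<in> S" for D
    proof -
      have D: "\<forall>(x, y)\<in>D. ?bad x y" and u: "\<forall>x x' y. (x, y) \<in> D \<longrightarrow> (x', y) \<in> D \<longrightarrow> x = x'"
        using that unfolding S_def arc_diagrams_iff_adj by fast+
      have sub: "toggle D \<subseteq> insert (i, j) D" by (auto simp: toggle_def)
      \<comment> \<open>All arcs of \<open>D\<close> are monochromatic edges, so an arc into
        \<open>j\<close> can only be \<open>(i, j)\<close>; inserting it does not give
        \<open>j\<close> a second incoming arc.\<close>
      have "x = i" if "(x, j) \<in> D" for x using D that uniq by blast
      then have "\<forall>x x' y. (x, y) \<in> insert (i, j) D \<longrightarrow> (x', y) \<in> insert (i, j) D \<longrightarrow> x = x'"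
        using u by blast
      moreover have "\<forall>(x, y)\<in>insert (i, j) D. ?bad x y" using D i by blast
      ultimately have 1: "\<forall>(x, y)\<in>toggle D. ?bad x y"
        and 2: "\<forall>x x' y. (x, y) \<in> toggle D \<longrightarrow> (x', y) \<in> toggle D \<longrightarrow> x = x'"
        using sub by (blast, meson subsetD)
      have "toggle D \<in> arc_diagrams n a" unfolding arc_diagrams_iff_adj using 1 2 by fast
      moreover have "\<forall>(x, y)\<in>toggle D. w x = w y" using 1 by fast
      ultimately show ?thesis by (simp add: S_def)
    qed
    have "(\<Sum>D\<in>S. (-1) ^ card D :: rat) = (\<Sum>D\<in>S. - ((-1) ^ card D))"
    proof (rule sum.reindex_bij_witness[of _ toggle toggle])
      fix D assume D: "D \<in> S"
      then have fin: "finite D" by (auto simp: S_def intro: finite_arc_diagram)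
      show "toggle (toggle D) = D" by (auto simp: toggle_def)
      show "toggle D \<in> S" by (rule toggle_S[OF D])
      show "- ((-1) ^ card (toggle D)) = ((-1) ^ card D :: rat)"
      proof (cases "(i, j) \<in> D")
        case True
        have c: "card D = Suc (card (D - {(i, j)}))" using fin True by (rule card.remove)
        show ?thesis unfolding toggle_def if_P[OF True] c by simp
      qed (use fin in \<open>simp add: toggle_def\<close>)
    next
      fix D assume "D \<in> S"
      then show "toggle D \<in> S" by (rule toggle_S)
      show "toggle (toggle D) = D" by (auto simp: toggle_def)
    qed
    then have "(\<Sum>D\<in>S. (-1) ^ card D :: rat) = 0" by (simp add: sum_negf)
    moreover have "Y_coeff (uig_adj n a) n w = 0"
      unfolding Y_coeff_def using False by (simp only: if_False)
    ultimately show ?thesis by simp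
  qed
  finally show ?thesis by simp
qed

section \<open>Comparison of the two expansions on a component\<close>

text \<open>This is the part of the relation \<open>sim_part\<close> that one component can see.
  \<open>Max C\<close> replaces \<open>n\<close>, with which it agrees if \<open>n\<close> lies in a
  component \<open>C\<close>; it is recorded everywhere so that all components are treated
  alike.\<close>

definition profile :: "nat set \<Rightarrow> nat set set \<Rightarrow> nat multiset \<times> nat" where
  "profile C P = (block_sizes P, card (\<Union>{B \<in> P. Max C \<in> B}))"

text \<open>The sign counts tic marks: \<open>Min C\<close> is a cut without a tic, hence
  \<open>card J - 1\<close>. The numerator counts the positions of the star in the last segment; the
  denominator is the share of \<open>C\<close> in the count of increasing labelings.\<close>

definition cut_weight :: "nat set \<Rightarrow> nat set \<Rightarrow> rat" where
  "cut_weight C J = (-1) ^ (card J - 1) * of_nat (card (\<Union>{B \<in> segments C J. Max C \<in> B})) /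
     (\<Prod>P\<in>segments C J. fact (card P))"

text \<open>Here \<open>k\<close> is the size of the block containing the maximum of the component.\<close>

definition component_sum :: "nat \<Rightarrow> (nat multiset \<times> nat \<Rightarrow> rat) \<Rightarrow> rat" where
  "component_sum m g =
     (\<Sum>k\<in>{1..m}. composition_sum (m - k) (\<lambda>M. g (add_mset k M, k)) / fact (k - 1))"

text \<open>The block of the maximum \<open>x\<close> is split off as \<open>insert x B\<close>.
  Exponent and factorial \<open>card P - 1\<close> then refer to the number of remaining blocks, so
  that \<open>sum_ordered_partitions_eq_composition_sum\<close> applies to
  \<open>A - B\<close>.\<close>

lemma sum_partitions_profile:
  assumes "finite C" "C \<noteq> {}"
  shows "(\<Sum>Q | partition_on C Q. p_to_e C Q * g (profile C Q)) = component_sum (card C) g"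
proof -
  define x A where "x = Max C" and "A = C - {x}"
  have C: "C = insert x A" "x \<notin> A" "finite A"
    using assms Max_in[OF assms] by (auto simp: x_def A_def simp del: Max_in)
  define m where "m = card A"
  have cC: "card C = Suc m" using C by (simp add: m_def)
  let ?K = "\<lambda>k. composition_sum (Suc m - k) (\<lambda>M. g (add_mset k M, k))"
  have inner: "(\<Sum>Q | partition_on (A - B) Q.
        p_to_e C (insert (insert x B) Q) * g (profile C (insert (insert x B) Q))) =
      fact (m - card B) * ?K (Suc (card B)) / fact m" if "B \<subseteq> A" for B
  proof -
    have finB: "finite B" "x \<notin> B" using finite_subset[OF that C(3)] that C(2) by auto
    have cB: "card (insert x B) = Suc (card B)" using finB by simp
    have cAB: "card (A - B) = m - card B" using finB that by (simp add: card_Diff_subset m_def)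
    have "p_to_e C (insert (insert x B) Q) * g (profile C (insert (insert x B) Q)) =
        (-1) ^ card Q * fact (card Q) * g (add_mset (Suc (card B)) (block_sizes Q), Suc (card B)) / fact m"
      if Q: "partition_on (A - B) Q" for Q
    proof -
      have "C - insert x B = A - B" by (auto simp: A_def)
      then have "partition_on (C - insert x B) Q" using Q by simp
      then have P: "partition_on C (insert (insert x B) Q)" "insert x B \<notin> Q"
        using partition_on_insert_block[of C "insert x B" Q] \<open>B \<subseteq> A\<close> C by auto
      have finQ: "finite Q" using Q finite_Diff[OF C(3)] by (rule partition_on_finiteD)
      have "\<Union>{D \<in> insert (insert x B) Q. x \<in> D} = insert x B"
        by (rule partition_on_Union_containing[OF P(1)]) auto
      then have "profile C (insert (insert x B) Q) = (add_mset (Suc (card B)) (block_sizes Q), Suc (card B))"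
        unfolding profile_def x_def[symmetric] using block_sizes_insert[OF finQ P(2)] cB by simp
      then show ?thesis unfolding p_to_e_def using finQ P(2) cC by simp
    qed
    then have "(\<Sum>Q | partition_on (A - B) Q.
        p_to_e C (insert (insert x B) Q) * g (profile C (insert (insert x B) Q))) =
      (\<Sum>Q | partition_on (A - B) Q.
        (-1) ^ card Q * fact (card Q) * g (add_mset (Suc (card B)) (block_sizes Q), Suc (card B))) / fact m"
      by (simp add: sum_divide_distrib)
    also have "\<dots> = fact (m - card B) * ?K (Suc (card B)) / fact m"
      using sum_ordered_partitions_eq_composition_sum[of "A - B" "\<lambda>M. g (add_mset (Suc (card B)) M, Suc (card B))"]
        C(3) cAB by simp
    finally show ?thesis .
  qed
  have "(\<Sum>Q | partition_on C Q. p_to_e C Q * g (profile C Q)) =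
     (\<Sum>B\<in>Pow A. fact (m - card B) * ?K (Suc (card B)) / fact m)"
    unfolding sum_partitions_insert_block[OF C(3,2), folded C(1)]
    using inner by (intro sum.cong) auto
  also have "\<dots> = (\<Sum>k\<le>m. of_nat (m choose k) * (fact (m - k) * ?K (Suc k) / fact m))"
    using sum_Pow_card[OF C(3), of "\<lambda>k. fact (m - k) * ?K (Suc k) / fact m"] by (simp add: m_def)
  \<comment> \<open>For k companions of the maximum, (m choose k) (m-k)!/m! = 1/k!; the block itself
    has size k+1.\<close>
  also have "\<dots> = (\<Sum>k\<le>m. ?K (Suc k) / fact k)"
    by (intro sum.cong) (auto simp: binomial_fact)
  also have "\<dots> = (\<Sum>k\<in>{1..Suc m}. ?K k / fact (k - 1))"
    by (rule sum.reindex_bij_witness[of _ "\<lambda>k. k - 1" Suc]) auto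
  finally show ?thesis by (simp add: component_sum_def cC)
qed

text \<open>The last segment contains the maximum. Its size \<open>b\<close> enters as
  \<open>b\<close> star positions over \<open>fact b\<close>, which is
  \<open>1 / fact (b - 1)\<close> and matches the weight in \<open>component_sum\<close>.\<close>

lemma sum_cuts_profile:
  assumes "finite C" "C \<noteq> {}"
  shows "(\<Sum>J\<in>cuts C. cut_weight C J * g (profile C (segments C J))) = component_sum (card C) g"
proof -
  let ?L = "\<lambda>j. {x \<in> C. x < j}" and ?H = "\<lambda>j. {x \<in> C. j \<le> x}"
  let ?K = "\<lambda>k. composition_sum (card C - k) (\<lambda>M. g (add_mset k M, k))"
  have inner: "(\<Sum>J\<in>cuts (?L j). cut_weight C (insert j J) * g (profile C (segments C (insert j J)))) =
      ?K (card (?H j)) / fact (card (?H j) - 1)" if j: "j \<in> C" for j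
  proof -
    define b where "b = card (?H j)"
    have "card C = card (?L j) + card (?H j)" using assms(1)
      by (subst card_Un_disjoint[symmetric]) (auto intro!: arg_cong[where f = card])
    then have cL: "card (?L j) = card C - b" by (simp add: b_def)
    have "b > 0" using j assms(1) by (auto simp: b_def card_gt_0_iff)
    then have fb: "of_nat b / fact b = (1 / fact (b - 1) :: rat)"
      by (cases b) (simp_all add: field_simps del: of_nat_Suc)
    have summand: "cut_weight C (insert j J) * g (profile C (segments C (insert j J))) =
        ((-1) ^ card J * g (add_mset b (block_sizes (segments (?L j) J)), b) /
          (\<Prod>P\<in>segments (?L j) J. fact (card P))) * (of_nat b / fact b)"
      if "J \<in> cuts (?L j)" for J
    proof -
      have sub: "J \<subseteq> ?L j" using that by (auto simp: cuts_def)
      then have finJ: "finite J" "j \<notin> J" using assms(1) finite_subset[of J C] by auto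
      have seg: "segments C (insert j J) = insert (?H j) (segments (?L j) J)"
        by (rule segments_insert_last[OF assms(1) j sub])
      have notin: "?H j \<notin> segments (?L j) J" by (rule last_segment_notin[OF j])
      have "Max C \<in> ?H j" using assms j by simp
      then have last: "\<Union>{B \<in> segments C (insert j J). Max C \<in> B} = ?H j"
        using partition_on_Union_containing[OF partition_on_segments[of C "insert j J"], of "?H j" "Max C"] seg
        by blast
      have "profile C (segments C (insert j J)) = (add_mset b (block_sizes (segments (?L j) J)), b)"
        unfolding profile_def last using seg notin assms(1) by (simp add: block_sizes_insert b_def)
      moreover have "cut_weight C (insert j J) =
          (-1) ^ card J * of_nat b / (fact b * (\<Prod>P\<in>segments (?L j) J. fact (card P)))"
        unfolding cut_weight_def last using seg notin assms(1) finJ by (simp add: b_def)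
      ultimately show ?thesis by (simp add: mult_ac)
    qed
    have "(\<Sum>J\<in>cuts (?L j). cut_weight C (insert j J) * g (profile C (segments C (insert j J)))) =
       (\<Sum>J\<in>cuts (?L j). (-1) ^ card J * g (add_mset b (block_sizes (segments (?L j) J)), b) /
          (\<Prod>P\<in>segments (?L j) J. fact (card P))) * (of_nat b / fact b)"
      unfolding sum_distrib_right using summand by (intro sum.cong) auto
    also have "\<dots> = ?K b * (of_nat b / fact b)"
      using sum_cuts_eq_composition_sum[of "?L j" "\<lambda>M. g (add_mset b M, b)"] assms(1) cL by simp
    finally show ?thesis unfolding fb unfolding b_def by simp
  qed
  have "(\<Sum>J\<in>cuts C. cut_weight C J * g (profile C (segments C J))) =
      (\<Sum>j\<in>C. ?K (card (?H j)) / fact (card (?H j) - 1))"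
    unfolding sum_cuts_last[OF assms] using inner by simp
  also have "\<dots> = component_sum (card C) g"
    unfolding component_sum_def
    by (rule sum_upper_segments[OF assms(1), of "\<lambda>k. ?K k / fact (k - 1)"])
  finally show ?thesis .
qed

section \<open>From single components to classes of partitions of the whole set\<close>

lemma block_sizes_Union_family:
  assumes "partition_on A R" "finite A" "\<And>C. C \<in> R \<Longrightarrow> partition_on C (f C)"
  shows "block_sizes (\<Union>(f ` R)) = (\<Sum>C\<in>R. block_sizes (f C))"
proof -
  have finR: "finite R" by (rule partition_on_finiteD[OF assms(1,2)])
  \<comment> \<open>The induction runs over subfamilies of \<open>R\<close>, which need not
    partition \<open>A\<close> but inherit disjointness.\<close>
  have "block_sizes (\<Union>(f ` S)) = (\<Sum>C\<in>S. block_sizes (f C))" if "S \<subseteq> R" for S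
    using finite_subset[OF that finR] that
  proof (induction S rule: finite_induct)
    case (insert C S)
    have fin: "finite (f D)" if "D \<in> R" for D
      using finite_block[OF assms(1,2)] assms(3) that by (auto intro: partition_on_finiteD)
    have "B \<notin> f D" if "B \<in> f C" "D \<in> S" for B D
    proof
      assume "B \<in> f D"
      then have "B \<subseteq> C" "B \<subseteq> D" "B \<noteq> {}"
        using partition_on_Diff_block assms(3) insert that by (metis insert_subset subsetD)+
      moreover have "C \<noteq> D" "C \<in> R" "D \<in> R" using insert(2,4) that by auto
      then have "C \<inter> D = {}" using partition_onD2[OF assms(1)] by (auto simp: disjoint_def)
      ultimately show False by blast
    qed
    then have disj: "f C \<inter> \<Union>(f ` S) = {}" by auto
    have "finite (f C)" "finite (\<Union>(f ` S))" using insert(1,4) fin by auto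
    then have "mset_set (f C \<union> \<Union>(f ` S)) = mset_set (f C) + mset_set (\<Union>(f ` S))"
      by (rule mset_set_Union[OF _ _ disj])
    then show ?case using insert by (simp add: block_sizes_def)
  qed (simp add: block_sizes_def)
  then show ?thesis by simp
qed

lemma card_block_of_top_Union_family:
  fixes n :: nat
  assumes "partition_on {1..n} R" "\<And>C. C \<in> R \<Longrightarrow> partition_on C (f C)"
  shows "card (\<Union>{B \<in> \<Union>(f ` R). n \<in> B}) =
    (\<Sum>C\<in>R. if n \<in> C then card (\<Union>{B \<in> f C. Max C \<in> B}) else 0)"
proof -
  have finR: "finite R" by (rule partition_on_finiteD[OF assms(1)]) simp
  have sub: "B \<subseteq> C" if "C \<in> R" "B \<in> f C" for B C
    by (rule partition_on_Diff_block(2)[OF assms(2)[OF that(1)] that(2)])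
  show ?thesis
  proof (cases "\<exists>C\<in>R. n \<in> C")
    case True
    then obtain C where C: "C \<in> R" "n \<in> C" by auto
    have uniq: "D = C" if "D \<in> R" "n \<in> D" for D
      using that C assms(1) by (auto simp: partition_on_def disjoint_def)
    have "C \<subseteq> {1..n}" using C assms(1) partition_on_Diff_block(2) by metis
    then have Max: "Max C = n" using C finite_subset[of C "{1..n}"] by (intro Max_eqI) auto
    have "{B \<in> \<Union>(f ` R). n \<in> B} = {B \<in> f C. n \<in> B}" using sub uniq C by blast
    moreover have "(\<Sum>D\<in>R. if n \<in> D then card (\<Union>{B \<in> f D. Max D \<in> B}) else 0) =
       (\<Sum>D\<in>{C}. if n \<in> D then card (\<Union>{B \<in> f D. Max D \<in> B}) else 0)"
    proof (rule sum.mono_neutral_right)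
      show "\<forall>D\<in>R - {C}. (if n \<in> D then card (\<Union>{B \<in> f D. Max D \<in> B}) else 0) = 0"
      proof
        fix D assume "D \<in> R - {C}"
        then have "n \<notin> D" using uniq by blast
        then show "(if n \<in> D then card (\<Union>{B \<in> f D. Max D \<in> B}) else 0) = 0" by simp
      qed
    qed (use finR C(1) in simp_all)
    ultimately show ?thesis using C Max by simp
  next
    \<comment> \<open>This happens for \<open>n = 0\<close> only, where the set to be partitioned is
      empty and both sides are 0.\<close>
    case False
    then have "{B \<in> \<Union>(f ` R). n \<in> B} = {}" using sub by blast
    moreover have "(\<Sum>C\<in>R. if n \<in> C then card (\<Union>{B \<in> f C. Max C \<in> B}) else 0) = 0"
      using False by (intro sum.neutral) auto
    ultimately show ?thesis by (simp only: Sup_empty card.empty)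
  qed
qed

text \<open>The class condition is phrased through the family of profiles alone, which is the form
  of \<open>G\<close> required by \<open>sum_PiE_transfer\<close>.\<close>

definition sim_indicator :: "nat \<Rightarrow> nat set set \<Rightarrow> nat set set \<Rightarrow> (nat set \<Rightarrow> nat multiset \<times> nat) \<Rightarrow> rat" where
  "sim_indicator n \<sigma> R F = of_bool ((\<Sum>C\<in>R. fst (F C)) = block_sizes \<sigma> \<and>
     (\<Sum>C\<in>R. if n \<in> C then snd (F C) else 0) = card (\<Union>{B \<in> \<sigma>. n \<in> B}))"

lemma sim_part_Union_family:
  assumes "partition_on {1..n} R" "\<And>C. C \<in> R \<Longrightarrow> partition_on C (f C)"
  shows "of_bool (sim_part n (\<Union>(f ` R)) \<sigma>) = sim_indicator n \<sigma> R (restrict (\<lambda>C. profile C (f C)) R)"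
proof -
  have "(\<Sum>C\<in>R. fst (restrict (\<lambda>C. profile C (f C)) R C)) = (\<Sum>C\<in>R. block_sizes (f C))"
    by (intro sum.cong) (auto simp: profile_def)
  moreover have "(\<Sum>C\<in>R. if n \<in> C then snd (restrict (\<lambda>C. profile C (f C)) R C) else 0) =
      (\<Sum>C\<in>R. if n \<in> C then card (\<Union>{B \<in> f C. Max C \<in> B}) else 0)"
    by (intro sum.cong) (auto simp: profile_def)
  moreover have "block_sizes (\<Union>(f ` R)) = (\<Sum>C\<in>R. block_sizes (f C))"
    by (rule block_sizes_Union_family[OF assms(1) finite_atLeastAtMost assms(2)])
  moreover have "card (\<Union>{B \<in> \<Union>(f ` R). n \<in> B}) =
      (\<Sum>C\<in>R. if n \<in> C then card (\<Union>{B \<in> f C. Max C \<in> B}) else 0)"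
    by (rule card_block_of_top_Union_family[OF assms])
  ultimately show ?thesis
    unfolding sim_part_def sim_indicator_def block_sizes_def[symmetric] by (simp only:)
qed

text \<open>A glued partition enters its class only through the profiles of its parts. Partitions of
  the components may therefore be exchanged for cut sets, the two local sums both being
  \<open>component_sum\<close>.\<close>

lemma sum_refinement_coeff_class:
  assumes R: "partition_on {1..n} R"
  shows "(\<Sum>P | P \<in> set_partitions n \<and> sim_part n P \<sigma>. refinement_coeff R P) =
    (\<Sum>F\<in>Pi\<^sub>E R cuts. (\<Prod>C\<in>R. cut_weight C (F C)) *
       of_bool (sim_part n (\<Union>C\<in>R. segments C (F C)) \<sigma>))"
proof -
  have finR: "finite R" and finC: "\<And>C. C \<in> R \<Longrightarrow> finite C"
    using R by (auto intro: partition_on_finiteD finite_block)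
  have neC: "\<And>C. C \<in> R \<Longrightarrow> C \<noteq> {}" using R by (auto simp: partition_on_def)
  let ?\<F> = "\<Pi>\<^sub>E C\<in>R. {Q. partition_on C Q}"
  have fin\<F>: "finite ?\<F>" using finR finC by (intro finite_PiE) auto
  have part: "partition_on {1..n} (\<Union>(f ` R))" if "f \<in> ?\<F>" for f
    using that by (intro partition_on_Union_family[OF R]) auto
  have "(\<Sum>P | P \<in> set_partitions n \<and> sim_part n P \<sigma>. refinement_coeff R P) =
     (\<Sum>P | P \<in> set_partitions n \<and> sim_part n P \<sigma>.
        \<Sum>f | f \<in> {f \<in> ?\<F>. sim_part n (\<Union>(f ` R)) \<sigma>} \<and> \<Union>(f ` R) = P. \<Prod>C\<in>R. p_to_e C (f C))"
    unfolding refinement_coeff_def by (intro sum.cong) auto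
  also have "\<dots> = (\<Sum>f | f \<in> ?\<F> \<and> sim_part n (\<Union>(f ` R)) \<sigma>. \<Prod>C\<in>R. p_to_e C (f C))"
    using fin\<F> part by (intro sum.group) (auto simp: set_partitions_def)
  also have "\<dots> = (\<Sum>f\<in>?\<F>. (\<Prod>C\<in>R. p_to_e C (f C)) * of_bool (sim_part n (\<Union>(f ` R)) \<sigma>))"
    using fin\<F> by (intro sum.mono_neutral_cong_left) auto
  also have "\<dots> = (\<Sum>f\<in>?\<F>. (\<Prod>C\<in>R. p_to_e C (f C)) *
      sim_indicator n \<sigma> R (restrict (\<lambda>C. profile C (f C)) R))"
    by (intro sum.cong refl arg_cong2[where f = "(*)"] sim_part_Union_family[OF R]) auto
  also have "\<dots> = (\<Sum>F\<in>Pi\<^sub>E R cuts. (\<Prod>C\<in>R. cut_weight C (F C)) *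
      sim_indicator n \<sigma> R (restrict (\<lambda>C. profile C (segments C (F C))) R))"
    using finC neC by (intro sum_PiE_transfer finR) (auto simp: sum_partitions_profile sum_cuts_profile)
  also have "\<dots> = (\<Sum>F\<in>Pi\<^sub>E R cuts. (\<Prod>C\<in>R. cut_weight C (F C)) *
       of_bool (sim_part n (\<Union>C\<in>R. segments C (F C)) \<sigma>))"
    by (intro sum.cong refl arg_cong2[where f = "(*)"] sim_part_Union_family[OF R, symmetric] partition_on_segments)
  finally show ?thesis .
qed

section \<open>Tic-marked arc diagrams as families of cut sets\<close>

text \<open>\<open>Min C\<close> is inserted because the leftmost segment of a component needs a
  left end although no arc ends there.\<close>

definition cut_of :: "(nat \<times> nat) set \<Rightarrow> nat set \<Rightarrow> nat set" where
  "cut_of T C = insert (Min C) (C \<inter> snd ` T)"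

definition labelings :: "nat \<Rightarrow> (nat \<times> nat) set \<Rightarrow> (nat \<times> nat) set \<Rightarrow> (nat \<Rightarrow> nat) set" where
  "labelings n D T = {\<delta>. \<delta> permutes {1..n} \<and>
     (\<forall>u\<in>{1..n}. \<forall>v\<in>{1..n}. u \<in> piece n D T v \<and> u < v \<longrightarrow> \<delta> u < \<delta> v)}"

definition star_sets :: "nat \<Rightarrow> (nat \<times> nat) set \<Rightarrow> (nat \<times> nat) set \<Rightarrow> nat set set" where
  "star_sets n D T = {S. S \<subseteq> {1..n} \<and>
     (\<forall>v\<in>{1..n}. card (S \<inter> piece n D T (Max (comp n D v))) = 1) \<and>
     (\<forall>s\<in>S. s \<in> piece n D T (Max (comp n D s)))}"

lemma AL'_eq_Sigma:
  "{(D, T, \<delta>, S) \<in> AL' n a. \<phi> D T} =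
     (SIGMA D:arc_diagrams n a. SIGMA T:{T \<in> Pow D. \<phi> D T}. labelings n D T \<times> star_sets n D T)"
  unfolding AL'_def labelings_def star_sets_def by auto

lemma piece_eq:
  "piece n D T v = {u \<in> comp n D v.
     card {j \<in> comp n D v \<inter> snd ` T. j \<le> u} = card {j \<in> comp n D v \<inter> snd ` T. j \<le> v}}"
proof -
  have *: "{j \<in> comp n D v. \<exists>i. (i, j) \<in> T} = comp n D v \<inter> snd ` T" by force
  show ?thesis by (simp only: piece_def Let_def *)
qed

lemma piece_self: "v \<in> {1..n} \<Longrightarrow> v \<in> piece n D T v"
  by (simp add: piece_eq comp_self)

lemma piece_eqI:
  assumes "u \<in> piece n D T v"
  shows "piece n D T u = piece n D T v"
proof -
  have "comp n D u = comp n D v" using assms comp_eqI by (simp add: piece_eq)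
  then show ?thesis using assms by (simp add: piece_eq)
qed

context
  fixes n :: nat and a :: "nat \<Rightarrow> nat" and D T :: "(nat \<times> nat) set"
  assumes D: "D \<in> arc_diagrams n a" and T: "T \<subseteq> D"
begin

private abbreviation "R \<equiv> comp n D ` {1..n}"

lemma Min_notin_ends: "C \<in> R \<Longrightarrow> Min C \<notin> snd ` T"
proof
  assume C: "C \<in> R" and "Min C \<in> snd ` T"
  then have "Min C \<in> C \<inter> snd ` D"
    using T comp_block_finite comp_block_nonempty by (metis IntI Min_in image_mono subsetD)
  then show False using right_ends_in_comp[OF D C] by blast
qed

text \<open>Passing from marked right ends to cuts adds \<open>Min C\<close>, which raises the count
  at every point of \<open>C\<close> by one and leaves the classes of equal counts as they
  are.\<close>

lemma segments_cut_of:
  assumes C: "C \<in> R"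
  shows "segments C (cut_of T C) = piece n D T ` C"
proof -
  let ?J = "C \<inter> snd ` T"
  have count: "card {j \<in> cut_of T C. j \<le> u} = Suc (card {j \<in> ?J. j \<le> u})" if "u \<in> C" for u
  proof -
    have "Min C \<le> u" using that comp_block_finite[OF C] by simp
    then have "{j \<in> cut_of T C. j \<le> u} = insert (Min C) {j \<in> ?J. j \<le> u}" by (auto simp: cut_of_def)
    then show ?thesis using Min_notin_ends[OF C] comp_block_finite[OF C] by simp
  qed
  have "piece n D T v = {u \<in> C. card {j \<in> cut_of T C. j \<le> u} = card {j \<in> cut_of T C. j \<le> v}}"
    if "v \<in> C" for v
    unfolding piece_eq comp_eq_block[OF C that] using that count by auto
  then show ?thesis unfolding segments_def by auto
qed

lemma pieces_partition_eq: "pieces_partition n D T = (\<Union>C\<in>R. segments C (cut_of T C))"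
proof -
  have "pieces_partition n D T = piece n D T ` {1..n}" by (auto simp: pieces_partition_def)
  also have "{1..n} = (\<Union>C\<in>R. C)" using partition_onD1[OF partition_on_comps] by simp
  also have "piece n D T ` \<dots> = (\<Union>C\<in>R. piece n D T ` C)" by blast
  finally show ?thesis using segments_cut_of by simp
qed

lemma partition_on_pieces: "partition_on {1..n} (pieces_partition n D T)"
  unfolding pieces_partition_eq
  by (rule partition_on_Union_family[OF partition_on_comps partition_on_segments])

lemma last_piece:
  assumes C: "C \<in> R"
  shows "\<Union>{B \<in> segments C (cut_of T C). Max C \<in> B} = piece n D T (Max C)"
proof (rule partition_on_Union_containing[OF partition_on_segments])
  have Max: "Max C \<in> C" using comp_block_finite[OF C] comp_block_nonempty[OF C] by simp
  then show "piece n D T (Max C) \<in> segments C (cut_of T C)" unfolding segments_cut_of[OF C] by simp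
  have "C \<subseteq> {1..n}" using C comp_subset by auto
  then show "Max C \<in> piece n D T (Max C)" using Max by (intro piece_self) auto
qed

lemma card_labelings:
  "of_nat (card (labelings n D T)) = (fact n / (\<Prod>B\<in>pieces_partition n D T. fact (card B)) :: rat)"
proof -
  have "labelings n D T = {\<delta>. \<delta> permutes {1..n} \<and> (\<forall>B\<in>pieces_partition n D T. strict_mono_on B \<delta>)}"
  proof (intro set_eqI iffI)
    fix \<delta> assume \<delta>: "\<delta> \<in> labelings n D T"
    have "strict_mono_on B \<delta>" if B: "B \<in> pieces_partition n D T" for B
    proof (rule strict_mono_onI)
      fix r s assume rs: "r \<in> B" "s \<in> B" "r < s"
      have "B \<subseteq> {1..n}" by (rule partition_on_Diff_block(2)[OF partition_on_pieces B])
      moreover have "B = piece n D T s"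
        using B rs(2) piece_eqI by (auto simp: pieces_partition_def)
      ultimately show "\<delta> r < \<delta> s" using rs \<delta> by (auto simp: labelings_def)
    qed
    then show "\<delta> \<in> {\<delta>. \<delta> permutes {1..n} \<and> (\<forall>B\<in>pieces_partition n D T. strict_mono_on B \<delta>)}"
      using \<delta> by (simp add: labelings_def)
  next
    fix \<delta> assume \<delta>: "\<delta> \<in> {\<delta>. \<delta> permutes {1..n} \<and> (\<forall>B\<in>pieces_partition n D T. strict_mono_on B \<delta>)}"
    have "\<delta> u < \<delta> v" if uv: "v \<in> {1..n}" "u \<in> piece n D T v" "u < v" for u v
    proof -
      have "piece n D T v \<in> pieces_partition n D T"
        unfolding pieces_partition_def using uv by blast
      then have "strict_mono_on (piece n D T v) \<delta>" using \<delta> by blast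
      moreover have "v \<in> piece n D T v" by (rule piece_self[OF uv(1)])
      ultimately show ?thesis using uv by (simp add: strict_mono_on_def)
    qed
    then show "\<delta> \<in> labelings n D T" using \<delta> by (simp add: labelings_def)
  qed
  then show ?thesis using card_increasing_permutations[OF partition_on_pieces] by simp
qed

text \<open>Star sets are the transversals of the right-most pieces. These are nonempty and lie in
  disjoint components, so different components have different pieces and the product may be indexed
  by \<open>R\<close>.\<close>

lemma card_star_sets: "card (star_sets n D T) = (\<Prod>C\<in>R. card (piece n D T (Max C)))"
proof -
  let ?P = "\<lambda>C. piece n D T (Max C)"
  have Max: "Max C \<in> C" if "C \<in> R" for C
    using comp_block_finite[OF that] comp_block_nonempty[OF that] by simp
  have sub: "?P C \<subseteq> C" if "C \<in> R" for C
    using comp_eq_block[OF that Max[OF that]] by (auto simp: piece_eq)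
  have ne: "?P C \<noteq> {}" if "C \<in> R" for C
    using last_piece[OF that] piece_self[of "Max C" n D T] Max[OF that] that comp_subset by blast
  have disjR: "C \<inter> C' = {}" if "C \<in> R" "C' \<in> R" "C \<noteq> C'" for C C'
    using partition_onD2[OF partition_on_comps, of n D] that by (auto simp: disjoint_def)
  have inj: "inj_on ?P R"
  proof (rule inj_onI, rule ccontr)
    fix C C' assume "C \<in> R" "C' \<in> R" "?P C = ?P C'" "C \<noteq> C'"
    then show False using sub[of C] sub[of C'] ne[of C] disjR[of C C'] by blast
  qed
  have "star_sets n D T = {S. S \<subseteq> \<Union>(?P ` R) \<and> (\<forall>B\<in>?P ` R. card (S \<inter> B) = 1)}"
  proof (intro set_eqI iffI)
    fix S assume S: "S \<in> star_sets n D T"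
    then have "s \<in> \<Union>(?P ` R)" if "s \<in> S" for s
      using that unfolding star_sets_def by blast
    then show "S \<in> {S. S \<subseteq> \<Union>(?P ` R) \<and> (\<forall>B\<in>?P ` R. card (S \<inter> B) = 1)}"
      using S by (auto simp: star_sets_def)
  next
    fix S assume S: "S \<in> {S. S \<subseteq> \<Union>(?P ` R) \<and> (\<forall>B\<in>?P ` R. card (S \<inter> B) = 1)}"
    have 1: "s \<in> {1..n} \<and> s \<in> ?P (comp n D s)" if s: "s \<in> S" for s
    proof -
      obtain C where C: "C \<in> R" "s \<in> ?P C" using S s by blast
      then have "s \<in> C" using sub by blast
      moreover have "comp n D s = C" by (rule comp_eq_block[OF C(1) \<open>s \<in> C\<close>])
      ultimately show ?thesis using C comp_subset by blast
    qed
    then show "S \<in> star_sets n D T" using S by (auto simp: star_sets_def)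
  qed
  moreover have "card {S. S \<subseteq> \<Union>(?P ` R) \<and> (\<forall>B\<in>?P ` R. card (S \<inter> B) = 1)} = (\<Prod>B\<in>?P ` R. card B)"
  proof (rule card_transversals)
    show "disjoint (?P ` R)"
    proof (rule disjointI)
      fix B B' assume "B \<in> ?P ` R" "B' \<in> ?P ` R" "B \<noteq> B'"
      then obtain C C' where *: "C \<in> R" "C' \<in> R" "B = ?P C" "B' = ?P C'" by (elim imageE) blast
      with \<open>B \<noteq> B'\<close> have "C \<inter> C' = {}" by (intro disjR) auto
      then show "B \<inter> B' = {}" using sub[OF *(1)] sub[OF *(2)] * by blast
    qed
    fix B assume "B \<in> ?P ` R"
    then obtain C where C: "C \<in> R" "B = ?P C" by (elim imageE) blast
    then show "finite B" using finite_subset[OF sub[OF C(1)] comp_block_finite[OF C(1)]] by simp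
  qed simp
  ultimately show ?thesis by (simp only: prod.reindex[OF inj] o_def)
qed

text \<open>Sign, label count and star count all split over the components except for
  \<open>fact n\<close>, the number of all labelings. This is the origin of the factor 1/n! in the
  theorem.\<close>

lemma card_labelings_star_sets:
  "of_nat (card (labelings n D T) * card (star_sets n D T)) * (-1) ^ card T =
     (fact n * (\<Prod>C\<in>R. cut_weight C (cut_of T C)) :: rat)"
proof -
  have prod_pieces: "(\<Prod>B\<in>pieces_partition n D T. fact (card B)) =
      (\<Prod>C\<in>R. \<Prod>B\<in>segments C (cut_of T C). fact (card B) :: rat)"
    unfolding pieces_partition_eq
  proof (rule prod.UNION_disjoint)
    show "\<forall>C\<in>R. \<forall>C'\<in>R. C \<noteq> C' \<longrightarrow> segments C (cut_of T C) \<inter> segments C' (cut_of T C') = {}"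
    proof (intro ballI impI)
      fix C C' assume *: "C \<in> R" "C' \<in> R" "C \<noteq> C'"
      then have "C \<inter> C' = {}"
        using partition_onD2[OF partition_on_comps, of n D] by (auto simp: disjoint_def)
      moreover have "B \<subseteq> C" "B \<noteq> {}" if "B \<in> segments C (cut_of T C)" for B
        using partition_on_Diff_block(2,3)[OF partition_on_segments that] by auto
      moreover have "B \<subseteq> C'" if "B \<in> segments C' (cut_of T C')" for B
        using partition_on_Diff_block(2)[OF partition_on_segments that] by auto
      ultimately show "segments C (cut_of T C) \<inter> segments C' (cut_of T C') = {}" by blast
    qed
    show "\<forall>C\<in>R. finite (segments C (cut_of T C))"
      using comp_block_finite finite_segments by blast
  qed simp
  have "card (cut_of T C) - 1 = card (C \<inter> snd ` T)" if "C \<in> R" for C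
    unfolding cut_of_def using Min_notin_ends[OF that] comp_block_finite[OF that] by simp
  then have weight: "cut_weight C (cut_of T C) = (-1) ^ card (C \<inter> snd ` T) *
      (of_nat (card (piece n D T (Max C))) / (\<Prod>B\<in>segments C (cut_of T C). fact (card B)))"
    if "C \<in> R" for C
    using that by (simp add: cut_weight_def last_piece[OF that])
  have "(\<Prod>C\<in>R. cut_weight C (cut_of T C)) = (\<Prod>C\<in>R. (-1) ^ card (C \<inter> snd ` T) *
      (of_nat (card (piece n D T (Max C))) / (\<Prod>B\<in>segments C (cut_of T C). fact (card B))))"
    using weight by (intro prod.cong refl)
  also have "\<dots> = (-1) ^ card T *
      (of_nat (card (star_sets n D T)) / (\<Prod>B\<in>pieces_partition n D T. fact (card B)))"
    unfolding prod.distrib prod_dividef power_sum[symmetric] card_arcs_by_component[OF D T, symmetric]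
      prod_pieces card_star_sets by simp
  finally show ?thesis by (simp add: card_labelings)
qed

end

text \<open>By \<open>right_ends_in_comp\<close>, sets of arcs amount to families of sets of
  non-minimal vertices. The inverse marks the arcs whose right end is a cut.\<close>

lemma bij_betw_cut_of:
  assumes D: "D \<in> arc_diagrams n a"
  shows "bij_betw (\<lambda>T. restrict (cut_of T) (comp n D ` {1..n})) (Pow D) (Pi\<^sub>E (comp n D ` {1..n}) cuts)"
proof -
  let ?R = "comp n D ` {1..n}"
  have Min: "Min C \<in> C" if "C \<in> ?R" for C
    using comp_block_finite[OF that] comp_block_nonempty[OF that] by simp
  have inC: "v \<in> comp n D v \<and> comp n D v \<in> ?R" if "(i, v) \<in> D" for i v
    using arc_diagram_less[OF D that] comp_self[of v n D] by auto
  show ?thesis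
  proof (rule bij_betw_byWitness[of _ "\<lambda>F. {(i, j) \<in> D. \<exists>C\<in>?R. j \<in> F C}"])
    show "\<forall>T\<in>Pow D. {(i, j) \<in> D. \<exists>C\<in>?R. j \<in> restrict (cut_of T) ?R C} = T"
    proof
      fix T assume T: "T \<in> Pow D"
      have "(i, j) \<in> T" if ij: "(i, j) \<in> D" and C: "C \<in> ?R" and j: "j \<in> cut_of T C" for i j C
      proof -
        \<comment> \<open>\<open>Min C\<close> belongs to \<open>cut_of T C\<close> without coming
          from a mark; as no arc ends there, it does not produce a marked arc.\<close>
        have "j \<noteq> Min C"
        proof
          assume "j = Min C"
          then have "Min C \<in> C \<inter> snd ` D" using ij Min[OF C] by force
          then show False using right_ends_in_comp[OF D C] by blast
        qed
        then obtain i' where "(i', j) \<in> T" using j by (auto simp: cut_of_def)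
        then show ?thesis using arc_diagram_unique[OF D ij] T by blast
      qed
      moreover have "j \<in> cut_of T (comp n D j)" if "(i, j) \<in> T" for i j
        using that T inC unfolding cut_of_def by force
      ultimately show "{(i, j) \<in> D. \<exists>C\<in>?R. j \<in> restrict (cut_of T) ?R C} = T"
        using T inC by fastforce
    qed
    show "\<forall>F\<in>Pi\<^sub>E ?R cuts. restrict (cut_of {(i, j) \<in> D. \<exists>C\<in>?R. j \<in> F C}) ?R = F"
    proof
      fix F assume F: "F \<in> Pi\<^sub>E ?R cuts"
      let ?T = "{(i, j) \<in> D. \<exists>C\<in>?R. j \<in> F C}"
      have FC: "F C \<subseteq> C" "Min C \<in> F C" if "C \<in> ?R" for C
        using PiE_mem[OF F that] comp_block_nonempty[OF that] by (auto simp: cuts_def)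
      have "cut_of ?T C = F C" if C: "C \<in> ?R" for C
      proof (rule subset_antisym)
        show "cut_of ?T C \<subseteq> F C"
        proof
          fix j assume "j \<in> cut_of ?T C"
          then have "j = Min C \<or> j \<in> C \<and> (\<exists>C'\<in>?R. j \<in> F C')" unfolding cut_of_def by auto
          then consider "j = Min C" | C' where "j \<in> C" "C' \<in> ?R" "j \<in> F C'" by blast
          then show "j \<in> F C"
          proof cases
            case 2
            then have "j \<in> C'" using FC(1)[OF \<open>C' \<in> ?R\<close>] by blast
            then have "C' = C" using comp_eq_block[OF C \<open>j \<in> C\<close>] comp_eq_block[OF \<open>C' \<in> ?R\<close>] by simp
            then show ?thesis using 2 by simp
          qed (use FC[OF C] in simp)
        qed
        show "F C \<subseteq> cut_of ?T C"
        proof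
          fix j assume j: "j \<in> F C"
          show "j \<in> cut_of ?T C"
          proof (cases "j = Min C")
            case False
            then have "j \<in> C \<inter> snd ` D" using right_ends_in_comp[OF D C] FC(1)[OF C] j by blast
            then obtain i where "(i, j) \<in> D" "j \<in> C" by auto
            then have "(i, j) \<in> ?T" using j C by blast
            then show ?thesis using \<open>j \<in> C\<close> by (force simp: cut_of_def)
          qed (simp add: cut_of_def)
        qed
      qed
      then show "restrict (cut_of ?T) ?R = F"
        using F by (auto simp: fun_eq_iff restrict_def PiE_def extensional_def)
    qed
    show "(\<lambda>T. restrict (cut_of T) ?R) ` Pow D \<subseteq> Pi\<^sub>E ?R cuts"
      using Min by (auto simp: cuts_def cut_of_def)
  qed auto
qed

section \<open>Summation over all markings and all diagrams\<close>

lemma sum_markings_eq_sum_refinement_coeff: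
  assumes D: "D \<in> arc_diagrams n a"
  shows "(\<Sum>T | T \<in> Pow D \<and> sim_part n (pieces_partition n D T) \<sigma>.
      of_nat (card (labelings n D T) * card (star_sets n D T)) * (-1) ^ card T) =
    fact n * (\<Sum>P | P \<in> set_partitions n \<and> sim_part n P \<sigma>. refinement_coeff (comp n D ` {1..n}) P)"
proof -
  let ?R = "comp n D ` {1..n}"
  let ?h = "\<lambda>F. (\<Prod>C\<in>?R. cut_weight C (F C)) * of_bool (sim_part n (\<Union>C\<in>?R. segments C (F C)) \<sigma>)"
  have "(\<Sum>T | T \<in> Pow D \<and> sim_part n (pieces_partition n D T) \<sigma>.
      of_nat (card (labelings n D T) * card (star_sets n D T)) * (-1) ^ card T) =
    (\<Sum>T\<in>Pow D. fact n * ?h (restrict (cut_of T) ?R))"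
  proof (rule sum.mono_neutral_cong_left)
    have *: "?h (restrict (cut_of T) ?R) =
        (\<Prod>C\<in>?R. cut_weight C (cut_of T C)) * of_bool (sim_part n (pieces_partition n D T) \<sigma>)"
      if "T \<subseteq> D" for T
    proof -
      have "(\<Union>C\<in>?R. segments C (restrict (cut_of T) ?R C)) = pieces_partition n D T"
        unfolding pieces_partition_eq[OF D that] by simp
      then show ?thesis by simp
    qed
    show "\<forall>T\<in>Pow D - {T \<in> Pow D. sim_part n (pieces_partition n D T) \<sigma>}.
        fact n * ?h (restrict (cut_of T) ?R) = 0"
    proof
      fix T assume "T \<in> Pow D - {T \<in> Pow D. sim_part n (pieces_partition n D T) \<sigma>}"
      then have T: "T \<subseteq> D" "\<not> sim_part n (pieces_partition n D T) \<sigma>" by auto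
      then show "fact n * ?h (restrict (cut_of T) ?R) = 0" unfolding *[OF T(1)] by simp
    qed
    fix T assume "T \<in> {T. T \<in> Pow D \<and> sim_part n (pieces_partition n D T) \<sigma>}"
    then have T: "T \<subseteq> D" "sim_part n (pieces_partition n D T) \<sigma>" by auto
    then show "of_nat (card (labelings n D T) * card (star_sets n D T)) * (-1) ^ card T =
        fact n * ?h (restrict (cut_of T) ?R)"
      unfolding *[OF T(1)] card_labelings_star_sets[OF D T(1)] by simp
  qed (use finite_arc_diagram[OF D] in auto)
  also have "\<dots> = (\<Sum>F\<in>Pi\<^sub>E ?R cuts. fact n * ?h F)"
    by (rule sum.reindex_bij_betw[OF bij_betw_cut_of[OF D]])
  also have "\<dots> = fact n * (\<Sum>P | P \<in> set_partitions n \<and> sim_part n P \<sigma>. refinement_coeff ?R P)"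
    unfolding sum_refinement_coeff_class[OF partition_on_comps] by (simp add: sum_distrib_left)
  finally show ?thesis .
qed

lemma sum_AL'_eq_sum_markings:
  "(\<Sum>(D, T, \<delta>, S)\<in>{(D, T, \<delta>, S) \<in> AL' n a. \<phi> D T}. (-1) ^ card T) =
   (\<Sum>D\<in>arc_diagrams n a. \<Sum>T | T \<in> Pow D \<and> \<phi> D T.
      of_nat (card (labelings n D T) * card (star_sets n D T)) * (-1) ^ card T :: rat)"
proof -
  have fin: "finite (labelings n D T \<times> star_sets n D T)" for D T
  proof (rule finite_cartesian_product)
    show "finite (labelings n D T)"
      by (rule finite_subset[OF _ finite_permutations[of "{1..n}"]]) (auto simp: labelings_def)
    show "finite (star_sets n D T)"
      by (rule finite_subset[of _ "Pow {1..n}"]) (auto simp: star_sets_def)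
  qed
  have finT: "finite {T \<in> Pow D. \<phi> D T}" if "D \<in> arc_diagrams n a" for D
    using finite_arc_diagram[OF that] by simp
  have "(\<Sum>(D, T, \<delta>, S)\<in>{(D, T, \<delta>, S) \<in> AL' n a. \<phi> D T}. (-1) ^ card T :: rat) =
    (\<Sum>D\<in>arc_diagrams n a. \<Sum>(T, \<delta>, S)\<in>(SIGMA T:{T \<in> Pow D. \<phi> D T}. labelings n D T \<times> star_sets n D T).
       (-1) ^ card T)"
    unfolding AL'_eq_Sigma using fin finT
    by (subst sum.Sigma) (auto simp: finite_arc_diagrams intro!: finite_SigmaI)
  also have "\<dots> = (\<Sum>D\<in>arc_diagrams n a. \<Sum>T | T \<in> Pow D \<and> \<phi> D T.
      \<Sum>(\<delta>, S)\<in>labelings n D T \<times> star_sets n D T. (-1) ^ card T)"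
    using fin finT by (intro sum.cong refl, subst sum.Sigma) auto
  finally show ?thesis by (simp add: case_prod_unfold card_cartesian_product)
qed

text \<open>A component of size m carries m-1 arcs, so the sign of a diagram distributes over its
  components and the signed power sums can be expanded.\<close>

lemma Y_coeff_eq_sum_refinement_coeff:
  "Y_coeff (uig_adj n a) n w =
     (\<Sum>P\<in>set_partitions n. (\<Sum>D\<in>arc_diagrams n a. refinement_coeff (comp n D ` {1..n}) P) * e_coeff P w)"
proof -
  have "(-1) ^ card D * (if \<forall>(i, j)\<in>D. w i = w j then 1 else 0) =
      (\<Sum>P\<in>set_partitions n. refinement_coeff (comp n D ` {1..n}) P * e_coeff P w)"
    if D: "D \<in> arc_diagrams n a" for D
  proof -
    let ?R = "comp n D ` {1..n}"
    have "(\<Sum>P\<in>set_partitions n. refinement_coeff ?R P * e_coeff P w) =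
      (\<Prod>C\<in>?R. (-1) ^ (card C - 1) * (if \<forall>x\<in>C. \<forall>y\<in>C. w x = w y then 1 else 0))"
      unfolding set_partitions_def
      by (rule signed_power_sum_eq_sum_refinements[OF finite_atLeastAtMost partition_on_comps, symmetric])
    also have "\<dots> = (if \<forall>C\<in>?R. \<forall>x\<in>C. \<forall>y\<in>C. w x = w y then \<Prod>C\<in>?R. (-1) ^ (card C - 1) else 0)"
      by (rule prod_sign_if) simp
    also have "(\<Prod>C\<in>?R. (-1) ^ (card C - 1)) = ((-1) ^ card D :: rat)"
      unfolding card_arc_diagram[OF D] by (rule power_sum[symmetric])
    finally have *: "(\<Sum>P\<in>set_partitions n. refinement_coeff ?R P * e_coeff P w) =
      (if \<forall>C\<in>?R. \<forall>x\<in>C. \<forall>y\<in>C. w x = w y then (-1) ^ card D else 0)" .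
    have "x * (if \<phi> then 1 else 0) = (if \<phi> then x else 0)" for x :: rat and \<phi> by simp
    then show ?thesis unfolding constant_on_arcs_iff[OF D] * .
  qed
  then have "Y_coeff (uig_adj n a) n w =
     (\<Sum>D\<in>arc_diagrams n a. \<Sum>P\<in>set_partitions n. refinement_coeff (comp n D ` {1..n}) P * e_coeff P w)"
    unfolding Y_coeff_eq_sum_arc_diagrams by (intro sum.cong refl)
  then show ?thesis by (subst (asm) sum.swap) (simp add: sum_distrib_right)
qed

theorem mainTheorem7:
  fixes n :: nat and a :: "nat \<Rightarrow> nat"
  assumes "unit_interval_seq n a"
  shows "(\<exists>c. \<forall>w. Y_coeff (uig_adj n a) n w
                   = (\<Sum>\<pi>\<in>set_partitions n. c \<pi> * e_coeff \<pi> w))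
       \<and> (\<forall>c. (\<forall>w. Y_coeff (uig_adj n a) n w
                   = (\<Sum>\<pi>\<in>set_partitions n. c \<pi> * e_coeff \<pi> w)) \<longrightarrow>
            (\<forall>\<sigma>\<in>set_partitions n.
               (\<Sum>\<pi>\<in>{\<pi> \<in> set_partitions n. sim_part n \<pi> \<sigma>}. c \<pi>)
             = (1 / fact n) *
               (\<Sum>(D, T, \<delta>, S)\<in>{(D, T, \<delta>, S) \<in> AL' n a. sim_part n (pieces_partition n D T) \<sigma>}.
                  (-1) ^ card T)))"
proof (intro conjI allI impI ballI)
  let ?c = "\<lambda>P. \<Sum>D\<in>arc_diagrams n a. refinement_coeff (comp n D ` {1..n}) P"
  show "\<exists>c. \<forall>w. Y_coeff (uig_adj n a) n w = (\<Sum>\<pi>\<in>set_partitions n. c \<pi> * e_coeff \<pi> w)"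
    using Y_coeff_eq_sum_refinement_coeff by (intro exI[of _ ?c]) blast
  fix c \<sigma>
  assume c: "\<forall>w. Y_coeff (uig_adj n a) n w = (\<Sum>\<pi>\<in>set_partitions n. c \<pi> * e_coeff \<pi> w)"
  have c_eq: "c P = ?c P" if "P \<in> set_partitions n" for P
  proof -
    \<comment> \<open>The difference of two expansions of the same \<open>Y_coeff\<close> vanishes
      at every coloring, so linear independence forces \<open>c\<close> to agree with
      \<open>?c\<close> on set partitions.\<close>
    have "(\<Sum>P | partition_on {1..n} P. (c P - ?c P) * e_coeff P w) = 0" for w
      using c Y_coeff_eq_sum_refinement_coeff[of n a w]
      by (simp add: left_diff_distrib sum_subtractf set_partitions_def)
    from e_coeff_linear_independent[OF finite_atLeastAtMost this]
    have "c P - ?c P = 0" using that by (simp add: set_partitions_def)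
    then show ?thesis by simp
  qed
  have "(\<Sum>\<pi>\<in>{\<pi> \<in> set_partitions n. sim_part n \<pi> \<sigma>}. c \<pi>) =
      (\<Sum>\<pi>\<in>{\<pi> \<in> set_partitions n. sim_part n \<pi> \<sigma>}. ?c \<pi>)"
    using c_eq by (intro sum.cong) auto
  also have "\<dots> = (\<Sum>D\<in>arc_diagrams n a. \<Sum>\<pi>\<in>{\<pi> \<in> set_partitions n. sim_part n \<pi> \<sigma>}.
      refinement_coeff (comp n D ` {1..n}) \<pi>)"
    by (rule sum.swap)
  also have "\<dots> = (1 / fact n) * (\<Sum>D\<in>arc_diagrams n a. fact n *
      (\<Sum>\<pi>\<in>{\<pi> \<in> set_partitions n. sim_part n \<pi> \<sigma>}. refinement_coeff (comp n D ` {1..n}) \<pi>))"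
    by (simp add: sum_distrib_left)
  also have "(\<Sum>D\<in>arc_diagrams n a. fact n *
      (\<Sum>\<pi>\<in>{\<pi> \<in> set_partitions n. sim_part n \<pi> \<sigma>}. refinement_coeff (comp n D ` {1..n}) \<pi>)) =
      (\<Sum>(D, T, \<delta>, S)\<in>{(D, T, \<delta>, S) \<in> AL' n a. sim_part n (pieces_partition n D T) \<sigma>}. (-1) ^ card T)"
    unfolding sum_AL'_eq_sum_markings
    by (intro sum.cong refl) (simp only: sum_markings_eq_sum_refinement_coeff)
  finally show "(\<Sum>\<pi>\<in>{\<pi> \<in> set_partitions n. sim_part n \<pi> \<sigma>}. c \<pi>) = (1 / fact n) *
      (\<Sum>(D, T, \<delta>, S)\<in>{(D, T, \<delta>, S) \<in> AL' n a. sim_part n (pieces_partition n D T) \<sigma>}. (-1) ^ card T)" .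
qed


end
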